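(* Let $X$ be a compact abelian topological group. Then every countably infinite subgroup $H$ of $X$ is $\mathfrak{g}$-closed.
   Context: All topological groups are Hausdorff; abelian groups are written additively. $\mathbb{T} = \mathbb{R}/\mathbb{Z}$, and $\omega$ is the set of natural numbers. For a topological abelian group $X$, $\widehat{X}$ is the group of continuous homomorphisms $X \to \mathbb{T}$. For a sequence $\underline{u} = \langle u_n : n \in \omega\rangle$ in $\widehat{X}$, $s_{\underline{u}}(X) = \{x \in X : u_n(x) \to 0 \text{ in } \mathbb{T}\}$. For a subgroup $H$ of $X$, $\mathfrak{g}\mathrm{cl}(H) = \bigcap \{ s_{\underline{u}}(X) : \underline{u} : \omega \to \widehat{X} \text{ and } H \subseteq s_{\underline{u}}(X)\}$. $H$ is $\mathfrak{g}$-closed iff $\mathfrak{g}\mathrm{cl}(H) = H$. *)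

theory Defs
  imports "HOL-Analysis.Analysis"
begin

definition int_congruent :: "real \<Rightarrow> real \<Rightarrow> bool"
  where "int_congruent x y \<longleftrightarrow> x - y \<in> \<int>"

lemma equivp_int_congruent: "equivp int_congruent"
proof (rule equivpI)
  show "reflp int_congruent"
    by (simp add: reflp_def int_congruent_def)
  show "symp int_congruent"
    unfolding symp_def int_congruent_def by (metis Ints_minus minus_diff_eq)
  show "transp int_congruent"
  proof (rule transpI)
    fix x y z
    assume "int_congruent x y" "int_congruent y z"
    then have "(x - y) + (y - z) \<in> \<int>"
      unfolding int_congruent_def by (rule Ints_add)
    then show "int_congruent x z"
      by (simp add: int_congruent_def)
  qed
qed

quotient_type circle = real / int_congruent
  morphisms rep_circle to_circle
  by (rule equivp_int_congruent)

instantiation circle :: ab_group_add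
begin

lift_definition zero_circle :: circle is 0 .

lift_definition plus_circle :: "circle \<Rightarrow> circle \<Rightarrow> circle" is "(+)"
proof -
  fix x x' y y'
  assume "int_congruent x x'" "int_congruent y y'"
  then have "(x - x') + (y - y') \<in> \<int>"
    unfolding int_congruent_def by (rule Ints_add)
  then show "int_congruent (x + y) (x' + y')"
    by (simp add: int_congruent_def algebra_simps)
qed

lift_definition uminus_circle :: "circle \<Rightarrow> circle" is uminus
proof -
  fix x x'
  assume "int_congruent x x'"
  then have "- (x - x') \<in> \<int>"
    unfolding int_congruent_def by (rule Ints_minus)
  then show "int_congruent (- x) (- x')"
    by (simp add: int_congruent_def)
qed

lift_definition minus_circle :: "circle \<Rightarrow> circle \<Rightarrow> circle" is "(-)"
proof -
  fix x x' y y'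
  assume "int_congruent x x'" "int_congruent y y'"
  then have "(x - x') - (y - y') \<in> \<int>"
    unfolding int_congruent_def by (rule Ints_diff)
  then show "int_congruent (x - y) (x' - y')"
    by (simp add: int_congruent_def algebra_simps)
qed

instance
  by standard (transfer; simp add: int_congruent_def)+

end

instantiation circle :: topological_space
begin

definition open_circle :: "circle set \<Rightarrow> bool"
  where "open_circle U \<longleftrightarrow> open (to_circle -` U)"

instance
  by standard (auto simp: open_circle_def vimage_Union)

end

lemma to_circle_eq_iff: "to_circle x = to_circle y \<longleftrightarrow> x - y \<in> \<int>"
  by (simp add: circle.abs_eq_iff int_congruent_def)

lemma surj_to_circle: "surj to_circle"
  unfolding surj_def
proof
  show "\<exists>x. a = to_circle x" for a
    by (induct a) blast
qed

lemma continuous_to_circle: "continuous_on A to_circle"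
  by (rule continuous_on_subset [OF _ subset_UNIV])
     (simp add: continuous_on_open_vimage open_circle_def)

lemma open_image_to_circle:
  assumes "open U"
  shows "open (to_circle ` U)"
proof -
  have "to_circle -` to_circle ` U = (\<Union>k::int. (+) (of_int k) ` U)"
  proof (intro set_eqI iffI)
    fix x assume "x \<in> to_circle -` to_circle ` U"
    then obtain y where "y \<in> U" "to_circle x = to_circle y"
      by blast
    then have "x - y \<in> \<int>"
      by (simp add: to_circle_eq_iff)
    then obtain k where "x - y = of_int k"
      by (rule Ints_cases)
    then have "x = of_int k + y"
      by simp
    with \<open>y \<in> U\<close> show "x \<in> (\<Union>k::int. (+) (of_int k) ` U)"
      by blast
  next
    fix x assume "x \<in> (\<Union>k::int. (+) (of_int k) ` U)"
    then obtain k :: int and y where "y \<in> U" "x = of_int k + y"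
      by blast
    then have "to_circle x = to_circle y"
      by (simp add: to_circle_eq_iff)
    with \<open>y \<in> U\<close> show "x \<in> to_circle -` to_circle ` U"
      by auto
  qed
  moreover have "open (\<Union>k::int. (+) (of_int k) ` U)"
    using assms by (intro open_UN ballI open_translation)
  ultimately show ?thesis
    by (simp add: open_circle_def)
qed

lemma nhds_to_circle: "nhds (to_circle x) = filtermap to_circle (nhds x)"
proof (rule filtermap_nhds_open_map [symmetric])
  show "isCont to_circle x"
    using continuous_to_circle [of UNIV] by (simp add: continuous_on_eq_continuous_at)
qed (rule open_image_to_circle)

instance circle :: topological_ab_group_add
proof
  fix a b :: circle
  obtain x y where ab: "a = to_circle x" "b = to_circle y"
    using surj_to_circle by (metis surjD)
  have "((\<lambda>p. to_circle (fst p + snd p)) \<longlongrightarrow> to_circle (x + y)) (nhds x \<times>\<^sub>F nhds y)"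
    by (rule continuous_on_tendsto_compose [OF continuous_to_circle [of UNIV]])
       (auto intro: tendsto_add_Pair)
  then show "((\<lambda>p. fst p + snd p) \<longlongrightarrow> a + b) (nhds a \<times>\<^sub>F nhds b)"
    unfolding ab plus_circle.abs_eq nhds_to_circle [of x] nhds_to_circle [of y]
      prod_filtermap1 prod_filtermap2 filterlim_filtermap
    by (simp add: plus_circle.abs_eq)
next
  fix a :: circle
  obtain x where a: "a = to_circle x"
    using surj_to_circle by (metis surjD)
  have "((\<lambda>z. to_circle (- z)) \<longlongrightarrow> to_circle (- x)) (nhds x)"
    by (rule continuous_on_tendsto_compose [OF continuous_to_circle [of UNIV]])
       (auto intro: tendsto_uminus_nhds)
  then show "(uminus \<longlongrightarrow> - a) (nhds a)"
    unfolding a uminus_circle.abs_eq nhds_to_circle [of x] filterlim_filtermap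
    by (simp add: uminus_circle.abs_eq)
qed

instance circle :: t2_space
proof
  fix a b :: circle
  assume "a \<noteq> b"
  obtain x y where ab: "a = to_circle x" "b = to_circle y"
    using surj_to_circle by (metis surjD)
  define e :: "real \<Rightarrow> complex" where "e x = cis (2 * pi * x)" for x
  have e_eq: "e x = e y \<longleftrightarrow> to_circle x = to_circle y" for x y
  proof -
    have "e x = e y \<longleftrightarrow> (\<exists>n::int. 2 * pi * x = 2 * pi * y + 2 * pi * of_int n)"
      unfolding e_def cis_conv_exp exp_eq
      by (simp add: complex_eq_iff algebra_simps)
    also have "\<dots> \<longleftrightarrow> (\<exists>n::int. x = y + of_int n)"
    proof -
      have "2 * pi * x = 2 * pi * y + 2 * pi * of_int n \<longleftrightarrow> x = y + of_int n" for n :: int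
        by (simp flip: distrib_left)
      then show ?thesis by simp
    qed
    also have "\<dots> \<longleftrightarrow> x - y \<in> \<int>"
      by (auto simp: Ints_def image_iff algebra_simps)
    finally show ?thesis by (simp add: to_circle_eq_iff)
  qed
  have "e x \<noteq> e y"
    using \<open>a \<noteq> b\<close> by (simp add: ab e_eq)
  then obtain U V where UV: "open U" "open V" "e x \<in> U" "e y \<in> V" "U \<inter> V = {}"
    using hausdorff by metis
  have cont: "continuous_on UNIV e"
    unfolding e_def by (intro continuous_intros)
  have op: "open (to_circle ` (e -` W))" if "open W" for W
    using cont that by (intro open_image_to_circle) (simp add: continuous_on_open_vimage)
  have "to_circle ` (e -` U) \<inter> to_circle ` (e -` V) = {}"
    using UV(5) by (auto simp: e_eq [symmetric])
  then show "\<exists>U V. open U \<and> open V \<and> a \<in> U \<and> b \<in> V \<and> U \<inter> V = {}"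
    using UV(1-4) op ab
    by (intro exI [of _ "to_circle ` (e -` U)"] exI [of _ "to_circle ` (e -` V)"] conjI) auto
qed

definition characters :: "('a::topological_ab_group_add \<Rightarrow> circle) set"
  where "characters =
    {f. continuous_on UNIV f \<and> (\<forall>x y. f (x + y) = f x + f y)}"

definition s_set :: "(nat \<Rightarrow> 'a::topological_ab_group_add \<Rightarrow> circle) \<Rightarrow> 'a set"
  where "s_set u = {x. (\<lambda>n. u n x) \<longlonglongrightarrow> 0}"

definition add_subgroup :: "'a::ab_group_add set \<Rightarrow> bool"
  where "add_subgroup H \<longleftrightarrow>
    0 \<in> H \<and> (\<forall>x\<in>H. \<forall>y\<in>H. x + y \<in> H) \<and> (\<forall>x\<in>H. - x \<in> H)"

text \<open>The family being intersected is never empty: the constant sequence of the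
  zero character belongs to it.\<close>

definition g_closure :: "'a::topological_ab_group_add set \<Rightarrow> 'a set"
  where "g_closure H = \<Inter> {s_set u | u. range u \<subseteq> characters \<and> H \<subseteq> s_set u}"

definition g_closed :: "'a::topological_ab_group_add set \<Rightarrow> bool"
  where "g_closed H \<longleftrightarrow> g_closure H = H"

end

(* Let x be a point outside H. For every finite subset K of H and every eps > 0 there is a
   continuous character that is eps-close to 0 on K but not close to 0 at x; letting K exhaust H
   and eps tend to 0 gives the sequence. Indeed, suppose that every character that is eps-close
   to 0 on K is close to 0 at x. View points of the group as characters of the abstract dual
   group, and take the mean of the evaluation at x against a trigonometric kernel, built from the
   evaluations at K, that concentrates where these are trivial. The mean is nonzero, so the
   evaluation at x agrees with the evaluation at a point of H. As continuous characters separate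
   points, x lies in H.

   Means are limits of averages over finitely many translates, so neither Haar measure nor
   amenability is needed. To separate a point z from 0, take an even continuous h that is a second
   difference of step z, so that convolution with h annihilates every character that is trivial
   at z. The power method applied to this convolution operator produces an eigenfunction of its
   square for a positive eigenvalue. The eigenspace is finite-dimensional and translation
   invariant, hence contains a character, which is nontrivial at z. *)
theory Submission
  imports Defs "Jordan_Normal_Form.Spectral_Radius"
begin

subsection \<open>Invariant means\<close>

text \<open>The step that puts x into H happens on the dual, where no topology is available. Hence
  means are defined on every abelian group and need not exist: for characters they come from
  geometric sums, for continuous functions on the compact group from uniform continuity. Since H is
  a subgroup, the kernel is a linear combination of evaluations at H, so orthogonality of characters
  would make its mean against any other evaluation vanish. That it does not vanish is a matter of
  rates: the mean of the N-th power of the kernel may itself be exponentially small, but finitely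
  many translates of the region where the kernel is large cover the group, so it decays more slowly
  than the error from the region where the kernel is small. For separation, the Fourier coefficient
  of the second difference at \<theta> is that of the original function times 1 - Re \<theta>(z).
  Evenness makes the convolution operator self-adjoint; its square has no negative eigenvalues, so
  that the normalised iterates cannot oscillate between two signs.\<close>

definition avg :: "'g::ab_group_add list \<Rightarrow> ('g \<Rightarrow> 'b::real_normed_vector) \<Rightarrow> 'g \<Rightarrow> 'b"
  where "avg as f x = (\<Sum>a\<leftarrow>as. f (x + a)) /\<^sub>R real (length as)"

text \<open>The approximation is uniform in \<open>x\<close>. This replaces integration against an
  invariant measure and makes sense on a group without topology.\<close>

definition has_mean :: "('g::ab_group_add \<Rightarrow> 'b::real_normed_vector) \<Rightarrow> 'b \<Rightarrow> bool"
  where "has_mean f c \<longleftrightarrow> (\<forall>\<epsilon>>0. \<exists>as. as \<noteq> [] \<and> (\<forall>x. norm (avg as f x - c) \<le> \<epsilon>))"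

lemma has_meanD:
  "has_mean f c \<Longrightarrow> \<epsilon> > 0 \<Longrightarrow> \<exists>as. as \<noteq> [] \<and> (\<forall>x. norm (avg as f x - c) \<le> \<epsilon>)"
  by (simp add: has_mean_def)

lemma avg_add: "avg as (\<lambda>x. f x + g x) x = avg as f x + avg as g x"
  by (simp add: avg_def sum_list_addf scaleR_add_right)

lemma sum_list_scaleR: "(\<Sum>a\<leftarrow>as. r *\<^sub>R f a) = r *\<^sub>R (\<Sum>a\<leftarrow>as. f a)"
  for f :: "'a \<Rightarrow> 'b::real_vector"
  by (induction as) (auto simp: scaleR_add_right)

lemma avg_const: "as \<noteq> [] \<Longrightarrow> avg as (\<lambda>x. c) x = c"
proof -
  have "(\<Sum>a\<leftarrow>as. c) = real (length as) *\<^sub>R c"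
    by (induction as) (auto simp: algebra_simps)
  then show "as \<noteq> [] \<Longrightarrow> ?thesis" by (simp add: avg_def)
qed

lemma avg_bounded_linear:
  assumes "bounded_linear T"
  shows "avg as (\<lambda>x. T (f x)) x = T (avg as f x)"
proof -
  interpret bounded_linear T by fact
  have "(\<Sum>a\<leftarrow>as. T (f (x + a))) = T (\<Sum>a\<leftarrow>as. f (x + a))"
    by (induction as) (auto simp: add zero)
  then show ?thesis by (simp add: avg_def scaleR)
qed

lemma avg_diff: "avg as (\<lambda>x. f x - g x) x = avg as f x - avg as g x"
  by (simp add: avg_def sum_list_subtractf scaleR_diff_right)

lemma sum_list_swap: "(\<Sum>a\<leftarrow>as. \<Sum>b\<leftarrow>bs. f a b) = (\<Sum>b\<leftarrow>bs. \<Sum>a\<leftarrow>as. f a b)"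
  for f :: "'a \<Rightarrow> 'b \<Rightarrow> 'c::comm_monoid_add"
  by (induction as) (auto simp: sum_list_addf)

text \<open>Commutativity of the group enters here; uniqueness and additivity of means rest on
  it.\<close>

lemma avg_commute: "avg as (avg bs f) x = avg bs (avg as f) x"
  unfolding avg_def sum_list_scaleR
  by (subst sum_list_swap) (simp add: add_ac mult.commute)

lemma norm_sum_list_le: "norm (\<Sum>a\<leftarrow>as. f a) \<le> (\<Sum>a\<leftarrow>as. norm (f a))"
  for f :: "'a \<Rightarrow> 'b::real_normed_vector"
  by (induction as) (auto intro: norm_triangle_le)

lemma sum_list_le_bound: "(\<And>a. a \<in> set as \<Longrightarrow> f a \<le> e) \<Longrightarrow> (\<Sum>a\<leftarrow>as. f a) \<le> real (length as) * e"
  for e :: real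
  by (induction as) (fastforce simp: algebra_simps)+

lemma norm_avg_le:
  assumes "as \<noteq> []" "\<And>x. norm (f x) \<le> e"
  shows "norm (avg as f x) \<le> e"
proof -
  have "norm (\<Sum>a\<leftarrow>as. f (x + a)) \<le> length as * e"
    by (rule order_trans[OF norm_sum_list_le sum_list_le_bound]) (rule assms)
  with assms(1) show ?thesis by (simp add: avg_def field_simps)
qed

lemma norm_avg_diff_le:
  assumes "as \<noteq> []" "\<And>x. norm (f x - c) \<le> e"
  shows "norm (avg as f x - c) \<le> e"
  using norm_avg_le[of as "\<lambda>x. f x - c", OF assms] assms(1) by (simp add: avg_diff avg_const)

text \<open>The new list consists of all sums a + b. Distinct pairs can have the same sum and must
  be counted with multiplicity, hence lists and not sets. One \<open>cs\<close> serves all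
  functions.\<close>

lemma avg_avg: "\<exists>cs. (as \<noteq> [] \<longrightarrow> bs \<noteq> [] \<longrightarrow> cs \<noteq> []) \<and> (\<forall>f::'g::ab_group_add \<Rightarrow> 'b::real_normed_vector. avg as (avg bs f) = avg cs f)"
proof (intro exI conjI allI ext)
  let ?cs = "concat (map (\<lambda>a. map ((+) a) bs) as)"
  show "as \<noteq> [] \<longrightarrow> bs \<noteq> [] \<longrightarrow> ?cs \<noteq> []" by (cases as; cases bs) auto
  fix f :: "'g \<Rightarrow> 'b" and x
  have len: "length ?cs = length as * length bs"
    by (induction as) auto
  have "(\<Sum>c\<leftarrow>?cs. f (x + c)) = (\<Sum>a\<leftarrow>as. \<Sum>b\<leftarrow>bs. f (x + a + b))"
    by (induction as) (auto simp: o_def add_ac)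
  then show "avg as (avg bs f) x = avg ?cs f x"
    by (simp only: avg_def len sum_list_scaleR) (simp add: add_ac)
qed

text \<open>Averaging keeps a function within any distance of a constant that it already had. The
  double average over both lists is therefore close to \<open>c\<close> and to \<open>d\<close> at
  once.\<close>

lemma has_mean_unique:
  assumes "has_mean f c" "has_mean f d"
  shows "c = d"
proof (rule ccontr)
  assume "c \<noteq> d"
  then have e: "norm (c - d) / 3 > 0" (is "?e > 0") by simp
  obtain as bs where as: "as \<noteq> []" "\<And>x. norm (avg as f x - c) \<le> ?e"
    and bs: "bs \<noteq> []" "\<And>x. norm (avg bs f x - d) \<le> ?e"
    using has_meanD[OF assms(1) e] has_meanD[OF assms(2) e] by blast
  have "norm (avg bs (avg as f) 0 - c) \<le> ?e" "norm (avg as (avg bs f) 0 - d) \<le> ?e"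
    by (rule norm_avg_diff_le[OF bs(1) as(2)], rule norm_avg_diff_le[OF as(1) bs(2)])
  then have "norm (c - d) \<le> ?e + ?e"
    using norm_diff_triangle_le[of c "avg as (avg bs f) 0" ?e d ?e]
    by (simp only: avg_commute[of as bs f 0] norm_minus_commute[of c])
  with \<open>c \<noteq> d\<close> show False by simp
qed

lemma has_mean_const: "has_mean (\<lambda>x. c) c"
  unfolding has_mean_def by (intro allI impI exI[of _ "[0]"]) (simp add: avg_const)

lemma has_mean_bounded_linear:
  assumes "has_mean f c" "bounded_linear T"
  shows "has_mean (\<lambda>x. T (f x)) (T c)"
  unfolding has_mean_def
proof (intro allI impI)
  fix \<epsilon> :: real assume "\<epsilon> > 0"
  obtain K where K: "K > 0" "\<And>x. norm (T x) \<le> norm x * K"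
    using bounded_linear.pos_bounded[OF assms(2)] by blast
  obtain as where as: "as \<noteq> []" "\<And>x. norm (avg as f x - c) \<le> \<epsilon> / K"
    using has_meanD[OF assms(1), of "\<epsilon> / K"] K(1) \<open>\<epsilon> > 0\<close> by auto
  have "norm (avg as (\<lambda>x. T (f x)) x - T c) \<le> \<epsilon>" for x
  proof -
    have "norm (avg as (\<lambda>x. T (f x)) x - T c) = norm (T (avg as f x - c))"
      by (simp add: avg_bounded_linear[OF assms(2)] linear_diff bounded_linear.linear[OF assms(2)])
    also have "\<dots> \<le> (\<epsilon> / K) * K"
      using K(1) by (intro order_trans[OF K(2)] mult_right_mono as) auto
    finally show ?thesis using K by simp
  qed
  with as show "\<exists>as. as \<noteq> [] \<and> (\<forall>x. norm (avg as (\<lambda>x. T (f x)) x - T c) \<le> \<epsilon>)" by blast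
qed

text \<open>The lists that suit \<open>f\<close> and \<open>g\<close> differ; the list for the
  double average suits both.\<close>

lemma has_mean_add:
  assumes "has_mean f c" "has_mean g d"
  shows "has_mean (\<lambda>x. f x + g x) (c + d)"
  unfolding has_mean_def
proof (intro allI impI)
  fix \<epsilon> :: real assume "\<epsilon> > 0"
  then obtain as bs where as: "as \<noteq> []" "\<And>x. norm (avg as f x - c) \<le> \<epsilon> / 2"
    and bs: "bs \<noteq> []" "\<And>x. norm (avg bs g x - d) \<le> \<epsilon> / 2"
    using has_meanD[OF assms(1), of "\<epsilon> / 2"] has_meanD[OF assms(2), of "\<epsilon> / 2"] by auto
  obtain cs where cs: "cs \<noteq> []" "\<And>f::'a \<Rightarrow> 'b. avg as (avg bs f) = avg cs f"
    using avg_avg[of as bs] as bs by metis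
  have "norm (avg cs (\<lambda>x. f x + g x) x - (c + d)) \<le> \<epsilon>" for x
  proof -
    have "norm (avg cs f x - c) \<le> \<epsilon>/2" "norm (avg cs g x - d) \<le> \<epsilon>/2"
      using norm_avg_diff_le[of bs "avg as f" c "\<epsilon>/2" x, OF bs(1) as(2)]
        norm_avg_diff_le[of as "avg bs g" d "\<epsilon>/2" x, OF as(1) bs(2)]
      by (simp_all only: avg_commute[of bs as] cs(2))
    from norm_triangle_mono[OF this] show ?thesis
      by (simp add: avg_add add_diff_add)
  qed
  with cs(1) show "\<exists>as. as \<noteq> [] \<and> (\<forall>x. norm (avg as (\<lambda>x. f x + g x) x - (c + d)) \<le> \<epsilon>)" by blast
qed

lemma has_mean_sum:
  "(\<And>i. i \<in> I \<Longrightarrow> has_mean (f i) (c i)) \<Longrightarrow> has_mean (\<lambda>x. \<Sum>i\<in>I. f i x) (\<Sum>i\<in>I. c i)"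
  by (induction I rule: infinite_finite_induct) (auto intro: has_mean_const has_mean_add)

lemma has_mean_diff:
  "has_mean f c \<Longrightarrow> has_mean g d \<Longrightarrow> has_mean (\<lambda>x. f x - g x) (c - d)"
  using has_mean_add[of f c "\<lambda>x. - g x" "- d"]
    has_mean_bounded_linear[of g d uminus, OF _ bounded_linear_minus[OF bounded_linear_ident]] by simp

text \<open>Used for lower bounds on a mean: some average of a function can be bounded below
  everywhere although the function itself is not.\<close>

lemma has_mean_avg_iff: "has_mean (avg bs f) c \<longleftrightarrow> has_mean f c" if "bs \<noteq> []"
proof
  assume *: "has_mean (avg bs f) c"
  show "has_mean f c" unfolding has_mean_def
  proof (intro allI impI)
    fix \<epsilon> :: real assume "\<epsilon> > 0"
    obtain as where "as \<noteq> []" "\<And>x. norm (avg as (avg bs f) x - c) \<le> \<epsilon>"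
      using has_meanD[OF * \<open>\<epsilon> > 0\<close>] by blast
    then show "\<exists>as. as \<noteq> [] \<and> (\<forall>x. norm (avg as f x - c) \<le> \<epsilon>)"
      using avg_avg[of as bs] that by (metis (no_types, lifting))
  qed
next
  assume *: "has_mean f c"
  show "has_mean (avg bs f) c" unfolding has_mean_def
  proof (intro allI impI)
    fix \<epsilon> :: real assume "\<epsilon> > 0"
    obtain as where as: "as \<noteq> []" "\<And>x. norm (avg as f x - c) \<le> \<epsilon>"
      using has_meanD[OF * \<open>\<epsilon> > 0\<close>] by blast
    then show "\<exists>as. as \<noteq> [] \<and> (\<forall>x. norm (avg as (avg bs f) x - c) \<le> \<epsilon>)"
      unfolding avg_commute[of _ bs f]
      using norm_avg_diff_le[of bs "avg as f" c \<epsilon>, OF that as(2)] by blast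
  qed
qed

lemma has_mean_translate: "has_mean f c \<Longrightarrow> has_mean (\<lambda>x. f (x + a)) c"
  using has_mean_avg_iff[of "[a]" f c] by (simp add: avg_def[abs_def])

lemma has_mean_uminus:
  assumes "has_mean f c" shows "has_mean (\<lambda>x. f (- x)) c"
  unfolding has_mean_def
proof (intro allI impI)
  fix \<epsilon> :: real assume "\<epsilon> > 0"
  obtain as where "as \<noteq> []" and as: "\<And>x. norm (avg as f x - c) \<le> \<epsilon>"
    using has_meanD[OF assms \<open>\<epsilon> > 0\<close>] by blast
  moreover have "avg (map uminus as) (\<lambda>x. f (- x)) x = avg as f (- x)" for x
    by (simp add: avg_def o_def)
  ultimately show "\<exists>as. as \<noteq> [] \<and> (\<forall>x. norm (avg as (\<lambda>x. f (- x)) x - c) \<le> \<epsilon>)"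
    by (intro exI[of _ "map uminus as"]) simp
qed

lemma has_mean_mono:
  fixes f :: "'g::ab_group_add \<Rightarrow> real"
  assumes "has_mean f c" "has_mean g d" "\<And>x. f x \<le> g x"
  shows "c \<le> d"
proof (rule ccontr)
  assume "\<not> c \<le> d"
  then have e: "(c - d) / 2 > 0" (is "?e > 0") by simp
  have "has_mean (\<lambda>x. g x - f x) (d - c)" using has_mean_diff assms by blast
  then obtain as where as: "as \<noteq> []" "\<And>x. norm (avg as (\<lambda>x. g x - f x) x - (d - c)) \<le> ?e"
    using has_meanD[OF _ e] by blast
  have "avg as (\<lambda>x. g x - f x) 0 \<ge> 0"
    unfolding avg_def using assms(3) by (auto intro!: mult_nonneg_nonneg sum_list_nonneg)
  with as(2)[of 0] e show False by (simp add: abs_le_iff)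
qed

lemma has_mean_norm_le:
  assumes "has_mean f c" "\<And>x. norm (f x) \<le> e"
  shows "norm c \<le> e"
proof (rule field_le_epsilon)
  fix d :: real assume "d > 0"
  obtain as where as: "as \<noteq> []" "\<And>x. norm (avg as f x - c) \<le> d"
    using has_meanD[OF assms(1) \<open>d > 0\<close>] by blast
  have "norm c \<le> norm (avg as f 0) + norm (avg as f 0 - c)"
    using norm_triangle_sub[of c "avg as f 0"] by (simp add: norm_minus_commute)
  also have "\<dots> \<le> e + d" by (intro add_mono norm_avg_le as assms)
  finally show "norm c \<le> e + d" .
qed

subsection \<open>Compact abelian groups\<close>

text \<open>In Fubini, double means are means on the product group, which therefore has to be a
  topological group as well.\<close>

instance prod :: (topological_monoid_add, topological_monoid_add) topological_monoid_add
proof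
  fix a b :: "'a \<times> 'b"
  have "((\<lambda>x. (fst (fst x) + fst (snd x), snd (fst x) + snd (snd x))) \<longlongrightarrow>
      (fst (fst (a, b)) + fst (snd (a, b)), snd (fst (a, b)) + snd (snd (a, b)))) (nhds (a, b))"
    by (intro tendsto_intros filterlim_ident)
  then show "((\<lambda>x. fst x + snd x) \<longlongrightarrow> a + b) (nhds a \<times>\<^sub>F nhds b)"
    by (simp add: plus_prod_def nhds_prod)
qed

instance prod :: (topological_group_add, topological_group_add) topological_group_add
proof
  fix a :: "'a \<times> 'b"
  have "((\<lambda>x. (- fst x, - snd x)) \<longlongrightarrow> (- fst a, - snd a)) (nhds a)"
    by (intro tendsto_intros filterlim_ident)
  then show "(uminus \<longlongrightarrow> - a) (nhds a)"
    by (simp add: uminus_prod_def[abs_def])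
qed

instance prod :: (topological_ab_group_add, topological_ab_group_add) topological_ab_group_add ..

text \<open>The tube lemma, applied to a neighbourhood of {0} times the whole group.\<close>

lemma compact_group_uniformly_continuous:
  fixes f :: "'a::topological_ab_group_add \<Rightarrow> 'b::metric_space"
  assumes "compact (UNIV :: 'a set)" "continuous_on UNIV f" "\<epsilon> > 0"
  obtains U where "open U" "0 \<in> U" "\<forall>u\<in>U. \<forall>x. dist (f (x + u)) (f x) < \<epsilon>"
proof -
  let ?W = "{p. dist (f (snd p + fst p)) (f (snd p)) < \<epsilon>}"
  have "continuous_on UNIV (\<lambda>p::'a \<times> 'a. f (snd p + fst p))" "continuous_on UNIV (\<lambda>p::'a \<times> 'a. f (snd p))"
    by (intro continuous_on_compose2[OF assms(2)] continuous_intros subset_UNIV)+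
  then have *: "open ?W"
    by (intro open_Collect_less continuous_intros)
  have **: "{0} \<times> UNIV \<subseteq> ?W" using assms(3) by auto
  from Elementary_Topology.tube_lemma[OF assms(1) * **]
  obtain U where U: "0 \<in> U \<and> open U \<and> U \<times> UNIV \<subseteq> ?W" by (elim exE)
  then have "dist (f (x + u)) (f x) < \<epsilon>" if "u \<in> U" for u x
    using that subsetD[of "U \<times> UNIV" ?W "(u, x)"] by simp
  with U that[of U] show thesis by simp
qed

lemma continuous_group_if_uniformly:
  fixes f :: "'a::topological_ab_group_add \<Rightarrow> 'b::metric_space"
  assumes "\<And>\<epsilon>. \<epsilon> > 0 \<Longrightarrow> \<exists>U. open U \<and> 0 \<in> U \<and> (\<forall>u\<in>U. \<forall>x. dist (f (x + u)) (f x) < \<epsilon>)"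
  shows "continuous_on UNIV f"
  unfolding continuous_on_def
proof (intro ballI tendstoI)
  fix x :: 'a and \<epsilon> :: real assume "\<epsilon> > 0"
  from assms[OF this] obtain U
    where U: "open U" "0 \<in> U" "\<forall>u\<in>U. \<forall>x. dist (f (x + u)) (f x) < \<epsilon>" by (elim exE conjE)
  have "((\<lambda>y. y - x) \<longlongrightarrow> x - x) (at x)"
    by (intro tendsto_diff tendsto_ident_at tendsto_const)
  then have "\<forall>\<^sub>F y in at x. y - x \<in> U" using U by (auto dest: topological_tendstoD)
  then show "\<forall>\<^sub>F y in at x. dist (f y) (f x) < \<epsilon>"
  proof eventually_elim
    case (elim y)
    with U(3) have "dist (f (x + (y - x))) (f x) < \<epsilon>" by blast
    then show ?case by simp
  qed
qed

lemma compact_group_finite_cover: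
  fixes U :: "'a::topological_ab_group_add set"
  assumes "compact (UNIV :: 'a set)" "open U" "0 \<in> U"
  obtains bs where "bs \<noteq> []" "\<forall>x. \<exists>b\<in>set bs. x - b \<in> U"
proof -
  have "open ((\<lambda>x. x - a) -` U)" for a
    by (intro open_vimage assms continuous_intros)
  moreover have "UNIV \<subseteq> (\<Union>a\<in>UNIV. (\<lambda>x. x - a) -` U)" using assms(3) by auto
  ultimately obtain F where "finite F" "UNIV \<subseteq> (\<Union>a\<in>F. (\<lambda>x. x - a) -` U)"
    using compactE_image[OF assms(1), of UNIV "\<lambda>a. (\<lambda>x. x - a) -` U"] by metis
  moreover obtain bs where "set bs = F" using finite_list[OF \<open>finite F\<close>] by blast
  ultimately show thesis by (intro that[of bs]) (fastforce)+
qed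

lemma compact_UNIV_bounded:
  fixes f :: "'a::topological_space \<Rightarrow> 'b::real_normed_vector"
  assumes "compact (UNIV :: 'a set)" "continuous_on UNIV f"
  obtains B where "B > 0" "\<And>x. norm (f x) \<le> B"
proof -
  have "bounded (range f)"
    using compact_continuous_image[OF assms(2,1)] by (rule compact_imp_bounded)
  then show thesis using that unfolding bounded_pos by blast
qed

lemma nonneg_member_le_sum_list:
  fixes f :: "'a \<Rightarrow> real"
  assumes "b \<in> set bs" "\<And>b. b \<in> set bs \<Longrightarrow> f b \<ge> 0"
  shows "f b \<le> (\<Sum>b\<leftarrow>bs. f b)"
  using assms
proof (induction bs)
  case (Cons a bs)
  have "(\<Sum>b\<leftarrow>bs. f b) \<ge> 0" "f a \<ge> 0" using Cons.prems by (auto intro!: sum_list_nonneg)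
  then show ?case using Cons by force
qed simp

text \<open>All averages share the modulus of continuity of \<open>f\<close>, so one neighbourhood
  serves every list.\<close>

lemma dist_avg_translate_le:
  assumes "as \<noteq> []" "\<And>x. dist (f (x + u)) (f x) \<le> \<epsilon>"
  shows "dist (avg as f (x + u)) (avg as f x) \<le> \<epsilon>"
proof -
  have "avg as f (x + u) = avg as (\<lambda>x. f (x + u)) x"
    by (simp add: avg_def add_ac)
  then show ?thesis
    using norm_avg_le[of as "\<lambda>x. f (x + u) - f x" \<epsilon> x] assms by (simp add: avg_diff dist_norm)
qed

text \<open>The mean is the infimum \<open>p\<close> of the uniform upper bounds of averages. An
  average that is nowhere much above \<open>p\<close> cannot be far below \<open>p\<close> on a fine
  net: averaging it over the net would push it below \<open>p\<close> everywhere. Equicontinuity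
  carries the bound from a translated net to all points.\<close>

lemma has_mean_exists_real:
  fixes f :: "'a::topological_ab_group_add \<Rightarrow> real"
  assumes X: "compact (UNIV :: 'a set)" and f: "continuous_on UNIV f"
  shows "\<exists>c. has_mean f c"
proof
  define S where "S = {s. \<exists>as. as \<noteq> [] \<and> (\<forall>x. avg as f x \<le> s)}"
  obtain B where B: "\<And>x. \<bar>f x\<bar> \<le> B" using compact_UNIV_bounded[OF X f] by auto
  have avg_le: "\<bar>avg as f x\<bar> \<le> B" if "as \<noteq> []" for as x
    using norm_avg_le[OF that, of f B] B by simp
  then have lower: "- B \<le> s" if "s \<in> S" for s
  proof -
    from that obtain as where "as \<noteq> []" "avg as f 0 \<le> s" unfolding S_def by blast
    with avg_le[of as 0] show ?thesis by linarith
  qed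
  have "B \<in> S" unfolding S_def using B by (auto intro!: exI[of _ "[0]"] simp: avg_def abs_le_iff)
  have bdd: "bdd_below S" using lower by (rule bdd_belowI)
  define p where "p = Inf S"
  show "has_mean f p" unfolding has_mean_def
  proof (intro allI impI)
    fix \<epsilon> :: real assume "\<epsilon> > 0"
    then have "\<epsilon> / 2 > 0" by simp
    from compact_group_uniformly_continuous[OF X f this]
    obtain U where U: "open U" "0 \<in> U" "\<forall>u\<in>U. \<forall>x. dist (f (x + u)) (f x) < \<epsilon> / 2" .
    obtain bs where bs: "bs \<noteq> []" "\<forall>x. \<exists>b\<in>set bs. x - b \<in> U"
      using compact_group_finite_cover[OF X U(1,2)] .
    define n where "n = real (length bs)"
    have n: "n \<ge> 1" using bs(1) by (cases bs) (auto simp: n_def)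
    \<comment> \<open>The n deficits \<open>?d b\<close> will be nonnegative with sum at most 2 n
      \<delta>; this choice makes each of them at most \<epsilon>/2.\<close>
    define \<delta> where "\<delta> = \<epsilon> / (4 * n)"
    have \<delta>: "\<delta> > 0" "2 * n * \<delta> = \<epsilon> / 2" "\<delta> \<le> \<epsilon>"
      using n \<open>\<epsilon> > 0\<close> by (auto simp: \<delta>_def field_simps)
    have "\<exists>s\<in>S. s < p + \<delta>"
      using \<delta>(1) \<open>B \<in> S\<close> cInf_lessD[of S "p + \<delta>"] unfolding p_def by auto
    then obtain s where "s < p + \<delta>" "\<exists>as. as \<noteq> [] \<and> (\<forall>x. avg as f x \<le> s)"
      unfolding S_def by blast
    then obtain as where as: "as \<noteq> []" and "\<forall>x. avg as f x \<le> s" by (elim exE conjE)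
    with \<open>s < p + \<delta>\<close> have le: "avg as f x \<le> p + \<delta>" for x
      by (meson less_imp_le order_trans)
    obtain cs where cs: "cs \<noteq> []" "avg bs (avg as f) = avg cs f"
      using avg_avg[of bs as] as bs(1) by blast
    \<comment> \<open>The average over the net is an average of \<open>f\<close> too, so it exceeds
      p - \<delta> somewhere.\<close>
    have "p - \<delta> \<notin> S" using cInf_lower[OF _ bdd, of "p - \<delta>"] \<delta>(1) unfolding p_def by auto
    then obtain x0 where x0: "avg bs (avg as f) x0 > p - \<delta>"
      using cs unfolding S_def by (auto simp: not_le)
    let ?d = "\<lambda>b. p + \<delta> - avg as f (x0 + b)"
    have "(\<Sum>b\<leftarrow>bs. ?d b) = n * (p + \<delta> - avg bs (avg as f) x0)"
      using n by (simp add: avg_def[of bs] sum_list_subtractf sum_list_triv n_def[symmetric] field_simps)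
    also have "\<dots> \<le> n * (2 * \<delta>)" using x0 n by (intro mult_left_mono) auto
    finally have "(\<Sum>b\<leftarrow>bs. ?d b) \<le> \<epsilon> / 2" using \<delta>(2) by (simp add: mult_ac)
    then have near: "?d b \<le> \<epsilon> / 2" if "b \<in> set bs" for b
      using nonneg_member_le_sum_list[OF that, of ?d] le by simp
    have "\<bar>avg as f x - p\<bar> \<le> \<epsilon>" for x
    proof -
      obtain b where b: "b \<in> set bs" "x - x0 - b \<in> U" using bs(2) by blast
      have "dist (avg as f (x0 + b + (x - x0 - b))) (avg as f (x0 + b)) \<le> \<epsilon> / 2"
        using U(3)[rule_format, OF b(2)] by (intro dist_avg_translate_le as less_imp_le)
      then have "\<bar>avg as f x - avg as f (x0 + b)\<bar> \<le> \<epsilon> / 2"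
        by (simp add: dist_real_def)
      with near[OF b(1)] le[of x] \<delta> show ?thesis by linarith
    qed
    with as show "\<exists>as. as \<noteq> [] \<and> (\<forall>x. norm (avg as f x - p) \<le> \<epsilon>)" by auto
  qed
qed

section \<open>The mean on a compact group: existence, Fubini, positivity\<close>

definition mean :: "('g::ab_group_add \<Rightarrow> 'b::real_normed_vector) \<Rightarrow> 'b"
  where "mean f = (THE c. has_mean f c)"

lemma mean_eqI: "has_mean f c \<Longrightarrow> mean f = c"
  unfolding mean_def using has_mean_unique by blast

lemma has_mean_mean:
  fixes f :: "'a::topological_ab_group_add \<Rightarrow> 'b::euclidean_space"
  assumes "compact (UNIV :: 'a set)" "continuous_on UNIV f"
  shows "has_mean f (mean f)"
proof -
  have "\<exists>c. has_mean (\<lambda>x. f x \<bullet> b) c" for b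
    by (intro has_mean_exists_real assms continuous_intros)
  then obtain c where c: "\<And>b. has_mean (\<lambda>x. f x \<bullet> b) (c b)" by metis
  have "has_mean (\<lambda>x. \<Sum>b\<in>Basis. (f x \<bullet> b) *\<^sub>R b) (\<Sum>b\<in>Basis. c b *\<^sub>R b)"
    by (intro has_mean_sum has_mean_bounded_linear[OF c] bounded_linear_scaleR_left)
  then have "has_mean f (\<Sum>b\<in>Basis. c b *\<^sub>R b)" by (simp add: euclidean_representation)
  then show ?thesis using mean_eqI by metis
qed

text \<open>Taking means in the second variable of an average over translates of \<open>F\<close>
  removes the second components of the translations and leaves the average of \<open>G\<close> over
  the first components.\<close>

lemma has_mean_Fubini:
  fixes F :: "'a::ab_group_add \<times> 'c::ab_group_add \<Rightarrow> 'b::real_normed_vector"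
  assumes "has_mean F c" "\<And>x. has_mean (\<lambda>y. F (x, y)) (G x)"
  shows "has_mean G c"
  unfolding has_mean_def
proof (intro allI impI)
  fix \<epsilon> :: real assume "\<epsilon> > 0"
  then obtain as where as: "as \<noteq> []" "\<And>x. norm (avg as F x - c) \<le> \<epsilon>"
    using has_meanD[OF assms(1) \<open>\<epsilon> > 0\<close>] by blast
  have sum: "has_mean (\<lambda>y. \<Sum>a\<leftarrow>as. F ((x, y) + a)) (\<Sum>a\<leftarrow>map fst as. G (x + a))" for x
  proof (induction as)
    case (Cons a as)
    have "has_mean (\<lambda>y. F (x + fst a, y + snd a)) (G (x + fst a))"
      using has_mean_translate[OF assms(2)] .
    from has_mean_add[OF this Cons] show ?case by (simp add: plus_prod_def)
  qed (simp add: has_mean_const)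
  have "has_mean (\<lambda>y. avg as F (x, y)) (avg (map fst as) G x)" for x
    using has_mean_bounded_linear[OF sum bounded_linear_scaleR_right] by (simp add: avg_def)
  then have "norm (avg (map fst as) G x - c) \<le> \<epsilon>" for x
    by (rule has_mean_norm_le[OF has_mean_diff[OF _ has_mean_const] as(2)])
  then show "\<exists>as. as \<noteq> [] \<and> (\<forall>x. norm (avg as G x - c) \<le> \<epsilon>)"
    using as(1) by (intro exI[of _ "map fst as"]) auto
qed

lemma has_mean_swap:
  fixes F :: "'a::ab_group_add \<times> 'c::ab_group_add \<Rightarrow> 'b::real_normed_vector"
  assumes "has_mean F c"
  shows "has_mean (F \<circ> prod.swap) c"
  unfolding has_mean_def
proof (intro allI impI)
  fix \<epsilon> :: real assume "\<epsilon> > 0"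
  then obtain as where as: "as \<noteq> []" "\<And>x. norm (avg as F x - c) \<le> \<epsilon>"
    using has_meanD[OF assms(1) \<open>\<epsilon> > 0\<close>] by blast
  have "avg (map prod.swap as) (F \<circ> prod.swap) x = avg as F (prod.swap x)" for x
    by (simp add: avg_def o_def plus_prod_def)
  with as show "\<exists>as. as \<noteq> [] \<and> (\<forall>x. norm (avg as (F \<circ> prod.swap) x - c) \<le> \<epsilon>)"
    by (intro exI[of _ "map prod.swap as"]) simp
qed

lemma mean_Fubini:
  fixes F :: "'a::topological_ab_group_add \<Rightarrow> 'a \<Rightarrow> 'b::euclidean_space"
  assumes X: "compact (UNIV :: 'a set)" and F: "continuous_on UNIV (\<lambda>(x, y). F x y)"
  shows "mean (\<lambda>x. mean (\<lambda>y. F x y)) = mean (\<lambda>y. mean (\<lambda>x. F x y))"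
proof -
  have "compact (UNIV :: ('a \<times> 'a) set)"
    using compact_Times[OF X X] by (simp add: UNIV_Times_UNIV)
  from has_mean_mean[OF this F] obtain c where c: "has_mean (\<lambda>(x, y). F x y) c" by blast
  have "has_mean (\<lambda>y. F x y) (mean (\<lambda>y. F x y))" "has_mean (\<lambda>y. F y x) (mean (\<lambda>y. F y x))" for x
    by (rule has_mean_mean[OF X continuous_on_compose2[OF F, of _ "Pair x", simplified]],
        intro continuous_intros,
        rule has_mean_mean[OF X continuous_on_compose2[OF F, of _ "\<lambda>y. (y, x)", simplified]],
        intro continuous_intros)
  then have "has_mean (\<lambda>x. mean (\<lambda>y. F x y)) c" "has_mean (\<lambda>y. mean (\<lambda>x. F x y)) c"
    using has_mean_Fubini[OF c] has_mean_Fubini[OF has_mean_swap[OF c]] by auto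
  then show ?thesis using mean_eqI by metis
qed

text \<open>Finitely many translates of the region where \<open>f\<close> exceeds
  \<open>f a / 2\<close> cover the group, so an average of \<open>f\<close> is bounded below by a
  positive constant.\<close>

lemma mean_pos:
  fixes f :: "'a::topological_ab_group_add \<Rightarrow> real"
  assumes X: "compact (UNIV :: 'a set)" and f: "continuous_on UNIV f"
    and "\<And>x. f x \<ge> 0" "f a > 0"
  shows "mean f > 0"
proof -
  have "f a / 2 > 0" using assms by simp
  from compact_group_uniformly_continuous[OF X f this]
  obtain U where U: "open U" "0 \<in> U" "\<forall>u\<in>U. \<forall>x. dist (f (x + u)) (f x) < f a / 2" .
  obtain bs where bs: "bs \<noteq> []" "\<forall>x. \<exists>b\<in>set bs. x - b \<in> U"
    using compact_group_finite_cover[OF X U(1,2)] .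
  \<comment> \<open>The cover controls x - b, whereas \<open>avg\<close> translates by
    adding.\<close>
  let ?bs = "map uminus bs"
  have "f a / 2 / length bs \<le> avg ?bs f x" for x
  proof -
    obtain b where b: "b \<in> set bs" "(x - a) - b \<in> U" using bs(2) by blast
    have "dist (f (x - b)) (f a) < f a / 2"
      using U(3)[rule_format, OF b(2), of a] by (simp add: algebra_simps)
    then have "f a / 2 \<le> f (x - b)" unfolding dist_real_def by linarith
    also have "\<dots> \<le> (\<Sum>b\<leftarrow>bs. f (x - b))"
      using b(1) assms(3) by (intro nonneg_member_le_sum_list[of b bs "\<lambda>b. f (x - b)"])
    finally have "f a / 2 / length bs \<le> (\<Sum>b\<leftarrow>bs. f (x - b)) / length bs"
      by (rule divide_right_mono) simp
    also have "\<dots> = avg ?bs f x"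
      by (simp add: avg_def o_def divide_inverse mult.commute)
    finally show ?thesis .
  qed
  moreover have "has_mean (avg ?bs f) (mean f)"
    using bs(1) has_mean_mean[OF X f] by (simp add: has_mean_avg_iff)
  ultimately have "f a / 2 / length bs \<le> mean f" using has_mean_mono[OF has_mean_const] by blast
  moreover have "f a / 2 / length bs > 0" using assms(4) bs(1) by simp
  ultimately show ?thesis by linarith
qed

subsection \<open>Convolution\<close>

text \<open>The kernel is real, but the other factor may be complex: characters are sought among the
  complex eigenfunctions of a real kernel.\<close>

definition conv :: "('a::ab_group_add \<Rightarrow> real) \<Rightarrow> ('a \<Rightarrow> 'b::real_normed_vector) \<Rightarrow> 'a \<Rightarrow> 'b"
  where "conv f g x = mean (\<lambda>y. f (x - y) *\<^sub>R g y)"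

lemma has_mean_reflect: "has_mean f c \<Longrightarrow> has_mean (\<lambda>y. f (x - y)) c"
  using has_mean_translate[OF has_mean_uminus, of f c "- x"] by simp

text \<open>Log-convexity makes the ratios increase and submultiplicativity bounds them by
  \<open>t 0\<close>, so they converge to some \<mu>. Every ratio is at most \<mu>, hence t n /
  \<mu>^n decreases. Submultiplicativity also bounds it below by \<mu>, and this is what keeps the
  later limit function from being zero.\<close>

lemma ratio_limit_of_log_convex:
  fixes t :: "nat \<Rightarrow> real"
  assumes pos: "\<And>n. t n > 0"
    and convex: "\<And>n. (t (Suc n))\<^sup>2 \<le> t n * t (Suc (Suc n))"
    and submult: "\<And>n m. t (Suc (n + m)) \<le> t n * t m"
  obtains \<mu> L where "\<mu> > 0" "L > 0" "(\<lambda>n. t n / \<mu> ^ n) \<longlonglongrightarrow> L"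
proof -
  define r where "r n = t (Suc n) / t n" for n
  have r_pos: "r n > 0" for n by (simp add: r_def pos)
  have "r n \<le> r (Suc n)" for n
    using convex[of n] pos[of n] pos[of "Suc n"] by (simp add: r_def field_simps power2_eq_square)
  then have inc: "incseq r" by (rule incseq_SucI)
  have "r n \<le> t 0" for n
    using submult[of n 0] pos[of n] by (simp add: r_def field_simps)
  then obtain \<mu> where lim: "r \<longlonglongrightarrow> \<mu>" and le: "\<And>n. r n \<le> \<mu>"
    using incseq_convergent[OF inc] by metis
  have "\<mu> > 0" using r_pos[of 0] le[of 0] by linarith
  have t_Suc: "t (Suc n) = r n * t n" for n using pos[of n] by (simp add: r_def)
  have grow: "t (k + m) \<ge> r m ^ k * t m" for k m
  proof (induction k)
    case (Suc k)
    have "r m \<le> r (k + m)" using inc by (simp add: incseq_def)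
    then have "r m * (r m ^ k * t m) \<le> r (k + m) * t (k + m)"
      using Suc r_pos[of m] pos[of m] r_pos[of "k + m"] by (intro mult_mono) (auto intro: less_imp_le)
    then show ?case by (simp add: t_Suc[of "k + m"] mult.assoc)
  qed simp
  \<comment> \<open>Growth from index m to \<open>Suc (n + m)\<close> is at least
    \<open>r m ^ Suc n\<close> and at most \<open>t n\<close>; \<open>t m\<close> cancels.\<close>
  have "r m ^ Suc n \<le> t n" for m n
  proof -
    have "r m ^ Suc n * t m \<le> t n * t m"
      using grow[where k="Suc n" and m=m] submult[of n m] by simp
    then show ?thesis using pos[of m] by simp
  qed
  then have lower: "\<mu> ^ Suc n \<le> t n" for n
    by (intro LIMSEQ_le_const2[OF tendsto_power[OF lim]]) auto
  have "t (Suc n) / \<mu> ^ Suc n \<le> t n / \<mu> ^ n" for n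
  proof -
    have "r n * t n \<le> \<mu> * t n" using le[of n] pos[of n] by simp
    then show ?thesis using \<open>\<mu> > 0\<close> by (simp add: t_Suc field_simps)
  qed
  then have dec: "decseq (\<lambda>n. t n / \<mu> ^ n)" by (rule decseq_SucI)
  have ge: "\<mu> \<le> t n / \<mu> ^ n" for n
    using lower[of n] \<open>\<mu> > 0\<close> by (simp add: field_simps)
  obtain L where L: "(\<lambda>n. t n / \<mu> ^ n) \<longlonglongrightarrow> L"
    using decseq_convergent[OF dec, of \<mu>] ge by metis
  have "L \<ge> \<mu>" using ge by (intro LIMSEQ_le_const[OF L]) auto
  with \<open>\<mu> > 0\<close> L show thesis by (intro that[of \<mu> L]) auto
qed

section \<open>Convolution operators and the power method\<close>

context
  assumes X: "compact (UNIV :: 'a::topological_ab_group_add set)"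
begin

lemma continuous_on_reflect:
  fixes f :: "'a \<Rightarrow> 'b::topological_space"
  shows "continuous_on UNIV f \<Longrightarrow> continuous_on UNIV (\<lambda>y. f (x - y))"
  by (rule continuous_on_compose2) (auto intro!: continuous_intros)

lemma has_mean_conv:
  fixes g :: "'a \<Rightarrow> 'b::euclidean_space"
  assumes "continuous_on UNIV f" "continuous_on UNIV g"
  shows "has_mean (\<lambda>y. f (x - y) *\<^sub>R g y) (conv f g x)"
  unfolding conv_def
  by (rule has_mean_mean[OF X]) (intro continuous_on_scaleR continuous_on_reflect assms)

lemma continuous_conv:
  fixes g :: "'a \<Rightarrow> 'b::euclidean_space"
  assumes "continuous_on UNIV f" "continuous_on UNIV g"
  shows "continuous_on UNIV (conv f g)"
proof (rule continuous_group_if_uniformly)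
  fix \<epsilon> :: real assume "\<epsilon> > 0"
  obtain B where B: "B > 0" "\<And>x. norm (g x) \<le> B" using compact_UNIV_bounded[OF X assms(2)] by metis
  have "\<epsilon> / (2 * B) > 0" using B(1) \<open>\<epsilon> > 0\<close> by simp
  from compact_group_uniformly_continuous[OF X assms(1) this]
  obtain U where U: "open U" "0 \<in> U" "\<forall>u\<in>U. \<forall>x. dist (f (x + u)) (f x) < \<epsilon> / (2 * B)" .
  have "dist (conv f g (x + u)) (conv f g x) < \<epsilon>" if "u \<in> U" for u x
  proof -
    have "norm (f (x + u - y) *\<^sub>R g y - f (x - y) *\<^sub>R g y) \<le> \<epsilon> / 2" for y
    proof -
      have "dist (f (x - y + u)) (f (x - y)) < \<epsilon> / (2 * B)" using U(3) that by blast
      then have "\<bar>f (x + u - y) - f (x - y)\<bar> * norm (g y) \<le> \<epsilon> / (2 * B) * B"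
        using B by (intro mult_mono) (auto simp: dist_real_def algebra_simps)
      then show ?thesis using B(1) by (simp flip: scaleR_diff_left)
    qed
    then have "norm (conv f g (x + u) - conv f g x) \<le> \<epsilon> / 2"
      by (rule has_mean_norm_le[OF has_mean_diff[OF has_mean_conv[OF assms] has_mean_conv[OF assms]]])
    then show ?thesis using \<open>\<epsilon> > 0\<close> by (simp add: dist_norm)
  qed
  with U(1,2) show "\<exists>U. open U \<and> 0 \<in> U \<and> (\<forall>u\<in>U. \<forall>x. dist (conv f g (x + u)) (conv f g x) < \<epsilon>)"
    by blast
qed

text \<open>Fubini, with translation invariance used to centre the inner mean at z.\<close>

lemma conv_assoc:
  fixes f g h :: "'a \<Rightarrow> real"
  assumes f: "continuous_on UNIV f" and g: "continuous_on UNIV g" and h: "continuous_on UNIV h"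
  shows "conv (conv f g) h = conv f (conv g h)"
proof
  fix x
  have F: "continuous_on UNIV (\<lambda>(z, y). f (x - y) * g (y - z) * h z)"
    unfolding split_beta
    by (intro continuous_intros continuous_on_compose2[OF f] continuous_on_compose2[OF g]
        continuous_on_compose2[OF h] subset_UNIV)
  have "conv (conv f g) h x = mean (\<lambda>z. mean (\<lambda>y. f (x - y) * g (y - z) * h z))"
  proof -
    have "conv f g (x - z) * h z = mean (\<lambda>y. f (x - y) * g (y - z) * h z)" for z
    proof (rule mean_eqI[symmetric])
      have "has_mean (\<lambda>y. f (x - y) * g (y - z)) (conv f g (x - z))"
        using has_mean_translate[OF has_mean_conv[OF f g, of "x - z"], of "- z"] by simp
      then show "has_mean (\<lambda>y. f (x - y) * g (y - z) * h z) (conv f g (x - z) * h z)"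
        by (rule has_mean_bounded_linear[OF _ bounded_linear_mult_left])
    qed
    then show ?thesis by (simp add: conv_def[of "conv f g"])
  qed
  also have "\<dots> = mean (\<lambda>y. mean (\<lambda>z. f (x - y) * g (y - z) * h z))"
    by (rule mean_Fubini[OF X F])
  also have "\<dots> = conv f (conv g h) x"
  proof -
    have "f (x - y) * conv g h y = mean (\<lambda>z. f (x - y) * g (y - z) * h z)" for y
      using has_mean_bounded_linear[OF has_mean_conv[OF g h, of y] bounded_linear_mult_right[of "f (x - y)"]]
      by (intro mean_eqI[symmetric]) (simp add: mult.assoc)
    then show ?thesis by (simp add: conv_def[of f])
  qed
  finally show "conv (conv f g) h x = conv f (conv g h) x" .
qed

lemma conv_even:
  fixes f g :: "'a \<Rightarrow> real"
  assumes "continuous_on UNIV f" "continuous_on UNIV g"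
    and "\<And>x. f (- x) = f x" "\<And>x. g (- x) = g x"
  shows "conv f g (- x) = conv f g x"
proof -
  have "f (x + y) = f (- x - y)" for y using assms(3)[of "x + y"] by simp
  then have "has_mean (\<lambda>y. f (- x - y) * g y) (conv f g x)"
    using has_mean_uminus[OF has_mean_conv[OF assms(1,2), of x]] by (simp add: assms(4))
  then show ?thesis unfolding conv_def[of f g "- x"] by (simp add: mean_eqI)
qed

lemma mean_Cauchy_Schwarz:
  fixes f g :: "'a \<Rightarrow> real"
  assumes f: "continuous_on UNIV f" and g: "continuous_on UNIV g"
  shows "(mean (\<lambda>x. f x * g x))\<^sup>2 \<le> mean (\<lambda>x. (f x)\<^sup>2) * mean (\<lambda>x. (g x)\<^sup>2)"
proof -
  define A where "A = mean (\<lambda>x. (f x)\<^sup>2)"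
  define B where "B = mean (\<lambda>x. f x * g x)"
  define C where "C = mean (\<lambda>x. (g x)\<^sup>2)"
  have A: "has_mean (\<lambda>x. (f x)\<^sup>2) A" and B: "has_mean (\<lambda>x. f x * g x) B"
    and C: "has_mean (\<lambda>x. (g x)\<^sup>2) C"
    unfolding A_def B_def C_def by (intro has_mean_mean[OF X] continuous_intros f g)+
  have quad: "0 \<le> A - 2 * s * B + s\<^sup>2 * C" for s
  proof -
    have "has_mean (\<lambda>x. (f x)\<^sup>2 - 2 * s * (f x * g x) + s\<^sup>2 * (g x)\<^sup>2) (A - 2 * s * B + s\<^sup>2 * C)"
      by (intro has_mean_add has_mean_diff A has_mean_bounded_linear[OF B bounded_linear_mult_right]
          has_mean_bounded_linear[OF C bounded_linear_mult_right])
    then have "has_mean (\<lambda>x. (f x - s * g x)\<^sup>2) (A - 2 * s * B + s\<^sup>2 * C)"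
      by (simp add: power2_diff power_mult_distrib algebra_simps)
    then show ?thesis by (rule has_mean_mono[OF has_mean_const]) simp
  qed
  have "C \<ge> 0" by (rule has_mean_mono[OF has_mean_const C]) simp
  have "B\<^sup>2 \<le> A * C"
  proof (cases "C = 0")
    case True
    have "B = 0"
    proof (rule ccontr)
      assume "B \<noteq> 0"
      \<comment> \<open>With C = 0 the quadratic is linear in s and takes the value -1 here.\<close>
      then show False using quad[of "(A + 1) / (2 * B)"] True by simp
    qed
    with True show ?thesis by simp
  next
    case False
    with \<open>C \<ge> 0\<close> have "C > 0" by simp
    then show ?thesis using quad[of "B / C"] by (simp add: field_simps power2_eq_square)
  qed
  then show ?thesis by (simp add: A_def B_def C_def)
qed

text \<open>A pointwise bound by mean squares: it turns Cauchy sequences in mean square into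
  uniformly Cauchy ones.\<close>

lemma conv_square_le:
  fixes f g :: "'a \<Rightarrow> real"
  assumes f: "continuous_on UNIV f" and g: "continuous_on UNIV g"
  shows "(conv f g x)\<^sup>2 \<le> mean (\<lambda>x. (f x)\<^sup>2) * mean (\<lambda>x. (g x)\<^sup>2)"
proof -
  have "has_mean (\<lambda>x. (f x)\<^sup>2) (mean (\<lambda>x. (f x)\<^sup>2))"
    by (intro has_mean_mean[OF X] continuous_intros f)
  then have "mean (\<lambda>y. (f (x - y))\<^sup>2) = mean (\<lambda>x. (f x)\<^sup>2)"
    by (intro mean_eqI has_mean_reflect[of "\<lambda>x. (f x)\<^sup>2"])
  then show ?thesis
    using mean_Cauchy_Schwarz[OF continuous_on_reflect[OF f, of x] g] by (simp add: conv_def)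
qed

lemma tendsto_conv:
  fixes P :: "nat \<Rightarrow> 'a \<Rightarrow> 'b::euclidean_space"
  assumes k: "continuous_on UNIV k" and P: "\<And>n. continuous_on UNIV (P n)" "continuous_on UNIV p"
    and lim: "uniform_limit UNIV P p sequentially"
  shows "(\<lambda>n. conv k (P n) x) \<longlonglongrightarrow> conv k p x"
proof (rule tendstoI)
  fix \<epsilon> :: real assume "\<epsilon> > 0"
  obtain B where B: "B > 0" "\<And>x. norm (k x) \<le> B" using compact_UNIV_bounded[OF X k] by metis
  have "\<epsilon> / (2 * B) > 0" using B(1) \<open>\<epsilon> > 0\<close> by simp
  from uniform_limitD[OF lim this]
  have "\<forall>\<^sub>F n in sequentially. \<forall>y\<in>UNIV. dist (P n y) (p y) < \<epsilon> / (2 * B)" .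
  then show "\<forall>\<^sub>F n in sequentially. dist (conv k (P n) x) (conv k p x) < \<epsilon>"
  proof eventually_elim
    case (elim n)
    have "norm (k (x - y) *\<^sub>R P n y - k (x - y) *\<^sub>R p y) \<le> \<epsilon> / 2" for y
    proof -
      have "norm (k (x - y)) * norm (P n y - p y) \<le> B * (\<epsilon> / (2 * B))"
        using elim B by (intro mult_mono) (auto simp: dist_norm less_imp_le)
      then show ?thesis using B(1) by (simp flip: scaleR_diff_right)
    qed
    then have "norm (conv k (P n) x - conv k p x) \<le> \<epsilon> / 2"
      by (rule has_mean_norm_le[OF has_mean_diff[OF has_mean_conv[OF k P(1)] has_mean_conv[OF k P(2)]]])
    then show ?case using \<open>\<epsilon> > 0\<close> by (simp add: dist_norm)
  qed
qed

text \<open>\<open>H n\<close> is the (n+1)-fold convolution power of \<open>h\<close>. By evenness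
  the inner product of \<open>H n\<close> and \<open>H m\<close> depends only on n + m, so the norms
  of all differences that occur are expressed by the single sequence \<open>t\<close>, whose
  normalisation converges. Convolution with \<open>conv h h\<close> raises the index by two, hence
  the limit of the normalised powers is an eigenfunction.\<close>

lemma conv_eigenfunction_exists:
  fixes h :: "'a \<Rightarrow> real"
  assumes h: "continuous_on UNIV h" and even: "\<And>x. h (- x) = h x" and nz: "h a \<noteq> 0"
  obtains \<mu> and p :: "'a \<Rightarrow> real"
  where "\<mu> > 0" "continuous_on UNIV p" "p 0 \<noteq> 0" "\<And>x. conv (conv h h) p x = \<mu> * p x"
proof -
  define H where "H n = (conv h ^^ n) h" for n
  have H0: "H 0 = h" and H_Suc: "H (Suc n) = conv h (H n)" for n by (simp_all add: H_def)
  have cont: "continuous_on UNIV (H n)" for n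
    by (induction n) (simp_all add: H0 H_Suc h continuous_conv)
  have H_even: "H n (- x) = H n x" for n x
  proof (induction n arbitrary: x)
    case (Suc n)
    show ?case unfolding H_Suc by (rule conv_even[OF h cont even Suc])
  qed (simp add: H0 even)
  have H_conv: "conv (H n) (H m) = H (Suc (n + m))" for n m
    by (induction n) (simp_all add: H0 H_Suc conv_assoc[OF h cont cont])
  have inner: "mean (\<lambda>y. H n y * H m y) = H (Suc (n + m)) 0" for n m
    unfolding H_conv[symmetric] conv_def by (simp add: H_even)
  define t where "t n = H (Suc (2 * n)) 0" for n
  have t_eq: "t n = mean (\<lambda>y. (H n y)\<^sup>2)" for n
    using inner[of n n] by (simp add: t_def power2_eq_square mult_2)
  have inner2: "mean (\<lambda>y. H n y * H m y) = t k" if "n + m = 2 * k" for n m k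
    by (simp add: inner t_def that)
  have t_pos_if: "t n > 0" if "H n b \<noteq> 0" for n b
    unfolding t_eq using that
    by (intro mean_pos[OF X, where a=b] continuous_intros cont) auto
  have convex: "(t (Suc n))\<^sup>2 \<le> t n * t (Suc (Suc n))" for n
    using mean_Cauchy_Schwarz[OF cont[of n] cont[of "Suc (Suc n)"]] inner2[of n "Suc (Suc n)" "Suc n"]
    by (simp add: t_eq)
  \<comment> \<open>Two consecutive terms are carried along because log-convexity yields the third.
    At the start, \<open>t 0\<close> is both the mean square of \<open>h\<close> and the value of
    \<open>H 1\<close> at 0, so \<open>H 1\<close> is not zero.\<close>
  have t_pos: "t n > 0 \<and> t (Suc n) > 0" for n
  proof (induction n)
    case 0
    have "t 0 > 0" using t_pos_if[of 0 a] nz by (simp add: H0)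
    then have "H 1 0 \<noteq> 0" by (simp add: t_def)
    with t_pos_if[of 1 0] \<open>t 0 > 0\<close> show ?case by simp
  next
    case (Suc n)
    have "0 < t n * t (Suc (Suc n))" using convex[of n] Suc by (smt (verit) zero_less_power)
    with Suc show ?case by (simp add: zero_less_mult_iff)
  qed
  have submult: "t (Suc (n + m)) \<le> t n * t m" for n m
  proof -
    have "has_mean (\<lambda>x. (H (Suc (n + m)) x)\<^sup>2) (t (Suc (n + m)))"
      unfolding t_eq by (intro has_mean_mean[OF X] continuous_intros cont)
    then show ?thesis
      by (rule has_mean_mono[OF _ has_mean_const])
        (use conv_square_le[OF cont[of n] cont[of m]] in \<open>simp add: H_conv t_eq\<close>)
  qed
  obtain \<mu> L where \<mu>: "\<mu> > 0" and L: "L > 0" "(\<lambda>n. t n / \<mu> ^ n) \<longlonglongrightarrow> L"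
    using ratio_limit_of_log_convex[of t] t_pos convex submult by blast
  \<comment> \<open>Odd indices: the value at 0 is t n / \<mu>^n, which tends to L > 0, and one
    factor \<open>h\<close> can be split off, leaving \<open>H (2 * n)\<close>.\<close>
  define P where "P n x = H (Suc (2 * n)) x / \<mu> ^ n" for n x
  have P_cont: "continuous_on UNIV (P n)" for n
    unfolding P_def[abs_def] using \<mu> by (intro continuous_intros cont) auto
  define a where "a n = t n / \<mu> ^ n" for n
  have P_diff: "(P n x - P m x)\<^sup>2 \<le> t 0 * (a (2 * n) - 2 * a (n + m) + a (2 * m))" for n m x
  proof -
    let ?q = "\<lambda>y. H (2 * n) y / \<mu> ^ n - H (2 * m) y / \<mu> ^ m"
    have q_cont: "continuous_on UNIV ?q" using \<mu> by (intro continuous_intros cont) auto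
    have eq: "P n x - P m x = conv h ?q x"
    proof -
      have "has_mean (\<lambda>y. h (x - y) * H (2 * k) y / \<mu> ^ k) (P k x)" for k
        using has_mean_bounded_linear[OF has_mean_conv[OF h cont[of "2 * k"], of x] bounded_linear_divide[of "\<mu> ^ k"]]
        by (simp add: P_def H_Suc)
      from has_mean_diff[OF this[of n] this[of m]]
      have "has_mean (\<lambda>y. h (x - y) *\<^sub>R ?q y) (P n x - P m x)"
        by (simp add: algebra_simps)
      then show ?thesis unfolding conv_def by (rule mean_eqI[symmetric])
    qed
    have m1: "has_mean (\<lambda>y. (H (2 * k) y)\<^sup>2 / \<mu> ^ (2 * k)) (a (2 * k))" for k
      unfolding a_def t_eq
      by (intro has_mean_bounded_linear[OF has_mean_mean[OF X] bounded_linear_divide] continuous_intros cont)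
    have "has_mean (\<lambda>y. H (2 * n) y * H (2 * m) y) (t (n + m))"
      using has_mean_mean[OF X, of "\<lambda>y. H (2 * n) y * H (2 * m) y"] inner2[of "2 * n" "2 * m" "n + m"] cont
      by (simp add: continuous_on_mult)
    then have m2: "has_mean (\<lambda>y. 2 * (H (2 * n) y * H (2 * m) y / \<mu> ^ (n + m))) (2 * a (n + m))"
      unfolding a_def
      by (intro has_mean_bounded_linear[OF _ bounded_linear_mult_right]
          has_mean_bounded_linear[OF _ bounded_linear_divide])
    have "has_mean (\<lambda>y. (?q y)\<^sup>2) (a (2 * n) - 2 * a (n + m) + a (2 * m))"
    proof -
      have "(?q y)\<^sup>2 = (H (2 * n) y)\<^sup>2 / \<mu> ^ (2 * n)
          - 2 * (H (2 * n) y * H (2 * m) y / \<mu> ^ (n + m)) + (H (2 * m) y)\<^sup>2 / \<mu> ^ (2 * m)" for y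
        by (simp add: power2_diff power_divide power_mult[symmetric] power_add mult.commute mult.left_commute)
      then show ?thesis
        using has_mean_add[OF has_mean_diff[OF m1[of n] m2] m1[of m]] by simp
    qed
    then have "mean (\<lambda>y. (?q y)\<^sup>2) = a (2 * n) - 2 * a (n + m) + a (2 * m)" by (rule mean_eqI)
    moreover have "t 0 = mean (\<lambda>y. (h y)\<^sup>2)" by (simp add: t_eq H0)
    ultimately show ?thesis using conv_square_le[OF h q_cont, of x] unfolding eq by simp
  qed
  have "uniformly_Cauchy_on UNIV P"
    unfolding uniformly_Cauchy_on_def
  proof (intro allI impI)
    fix \<epsilon> :: real assume "\<epsilon> > 0"
    \<comment> \<open>The second difference of \<open>a\<close> is at most 4 \<delta>, so the square
      of the distance is at most half of the allowed one.\<close>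
    define \<delta> where "\<delta> = \<epsilon>\<^sup>2 / (8 * t 0)"
    have "\<delta> > 0" using \<open>\<epsilon> > 0\<close> t_pos[of 0] by (simp add: \<delta>_def)
    then obtain N where N: "\<And>n. n \<ge> N \<Longrightarrow> \<bar>a n - L\<bar> < \<delta>"
      using L(2) unfolding a_def[symmetric] by (metis LIMSEQ_iff real_norm_def)
    have "dist (P m x) (P n x) < \<epsilon>" if "m \<ge> N" "n \<ge> N" for m n x
    proof -
      have "a (2 * m) - 2 * a (m + n) + a (2 * n) \<le> 4 * \<delta>"
        using N[of "2 * m"] N[of "m + n"] N[of "2 * n"] that by linarith
      then have "t 0 * (a (2 * m) - 2 * a (m + n) + a (2 * n)) \<le> t 0 * (4 * \<delta>)"
        using t_pos[of 0] by (intro mult_left_mono) auto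
      also have "\<dots> < \<epsilon>\<^sup>2" using t_pos[of 0] \<open>\<epsilon> > 0\<close> by (simp add: \<delta>_def)
      finally have "(P m x - P n x)\<^sup>2 < \<epsilon>\<^sup>2" using P_diff[of m x n] by linarith
      then have "\<bar>P m x - P n x\<bar> < \<epsilon>" using \<open>\<epsilon> > 0\<close> power2_less_imp_less[of "\<bar>P m x - P n x\<bar>" \<epsilon>] by simp
      then show ?thesis using \<open>\<epsilon> > 0\<close> by (simp add: dist_real_def)
    qed
    then show "\<exists>M. \<forall>x\<in>UNIV. \<forall>m\<ge>M. \<forall>n\<ge>M. dist (P m x) (P n x) < \<epsilon>" by blast
  qed
  then obtain p where p: "uniform_limit UNIV P p sequentially"
    using Cauchy_uniformly_convergent unfolding uniformly_convergent_on_def by blast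
  have p_cont: "continuous_on UNIV p"
    using P_cont by (intro uniform_limit_theorem[OF _ p]) auto
  have Plim: "(\<lambda>n. P n x) \<longlonglongrightarrow> p x" for x using tendsto_uniform_limitI[OF p] by simp
  have "p 0 = L" using Plim[of 0] L(2) unfolding P_def t_def[symmetric] by (rule LIMSEQ_unique)
  have "conv (conv h h) p x = \<mu> * p x" for x
  proof -
    have "conv (conv h h) (P n) x = \<mu> * P (Suc n) x" for n
    proof -
      have k: "conv h h = H 1" by (simp add: H0 H_Suc)
      have "has_mean (\<lambda>y. H 1 (x - y) * H (Suc (2 * n)) y / \<mu> ^ n) (conv (H 1) (H (Suc (2 * n))) x / \<mu> ^ n)"
        using has_mean_bounded_linear[OF has_mean_conv[OF cont[of 1] cont[of "Suc (2 * n)"], of x] bounded_linear_divide[of "\<mu> ^ n"]]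
        by simp
      then have "conv (H 1) (P n) x = conv (H 1) (H (Suc (2 * n))) x / \<mu> ^ n"
        unfolding conv_def[of _ "P n"] P_def by (intro mean_eqI) simp
      then show ?thesis using \<mu> by (simp add: k H_conv P_def)
    qed
    moreover have "(\<lambda>n. conv (conv h h) (P n) x) \<longlonglongrightarrow> conv (conv h h) p x"
      by (rule tendsto_conv[OF continuous_conv[OF h h] P_cont p_cont p])
    moreover have "(\<lambda>n. \<mu> * P (Suc n) x) \<longlonglongrightarrow> \<mu> * p x"
      by (intro tendsto_intros LIMSEQ_Suc Plim)
    ultimately show ?thesis using LIMSEQ_unique by simp
  qed
  with \<mu> p_cont L(1) \<open>p 0 = L\<close> show thesis by (intro that[of \<mu> p]) auto
qed

end

subsection \<open>Continuous characters separate points\<close>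

definition unitary_character :: "('g::ab_group_add \<Rightarrow> complex) \<Rightarrow> bool"
  where "unitary_character \<theta> \<longleftrightarrow> (\<forall>x y. \<theta> (x + y) = \<theta> x * \<theta> y) \<and> (\<forall>x. norm (\<theta> x) = 1)"

section \<open>Common eigenfunctions of translations on finite-dimensional spaces\<close>

lemma eigenvector_exists:
  fixes A :: "'p \<Rightarrow> 'p \<Rightarrow> complex"
  assumes P: "finite P" "P \<noteq> {}"
  obtains z v p where "p \<in> P" "v p \<noteq> 0" "\<And>p. p \<in> P \<Longrightarrow> (\<Sum>q\<in>P. A p q * v q) = z * v p"
proof -
  define n where "n = card P"
  have "n > 0" using P by (simp add: n_def card_gt_0_iff)
  obtain e where e: "bij_betw e {0..<n} P" using ex_bij_betw_nat_finite[OF P(1)] n_def by auto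
  define M where "M = Matrix.mat n n (\<lambda>(i, j). A (e i) (e j))"
  have M: "M \<in> carrier_mat n n" by (simp add: M_def)
  obtain z w where w: "w \<in> carrier_vec n" "w \<noteq> 0\<^sub>v n" and eq: "M *\<^sub>v w = z \<cdot>\<^sub>v w"
    using spectrum_non_empty[OF M \<open>n > 0\<close>] M
    unfolding spectrum_def eigenvalue_def eigenvector_def by auto
  define v where "v p = vec_index w (the_inv_into {0..<n} e p)" for p
  have v: "v (e i) = vec_index w i" if "i < n" for i
    using e that by (simp add: v_def the_inv_into_f_f bij_betw_def)
  obtain i where i: "i < n" "vec_index w i \<noteq> 0"
    using w by (metis carrier_vecD eq_vecI index_zero_vec)
  have "(\<Sum>q\<in>P. A p q * v q) = z * v p" if "p \<in> P" for p
  proof -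
    have "p \<in> e ` {0..<n}" using e that by (simp add: bij_betw_def)
    then obtain i where i: "i < n" "p = e i" by auto
    have "(\<Sum>q\<in>P. A p q * v q) = (\<Sum>j = 0..<n. A p (e j) * vec_index w j)"
      using sum.reindex_bij_betw[OF e, of "\<lambda>q. A p q * v q"] v by simp
    also have "\<dots> = vec_index (M *\<^sub>v w) i"
      using i w(1) by (simp add: M_def scalar_prod_def)
    also have "\<dots> = z * v p" using i w(1) v by (simp add: eq)
    finally show ?thesis .
  qed
  then show thesis using that[of "e i" v z] i v e by (auto simp: bij_betw_def)
qed

text \<open>The single rule f + c g also yields scalar multiples, as f + (c - 1) f, and the zero
  function, as f - f.\<close>

definition translation_invariant_space :: "('g::ab_group_add \<Rightarrow> complex) set \<Rightarrow> bool"
  where "translation_invariant_space W \<longleftrightarrow>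
    (\<forall>f\<in>W. \<forall>g\<in>W. \<forall>c. (\<lambda>x. f x + c * g x) \<in> W) \<and> (\<forall>f\<in>W. \<forall>a. (\<lambda>x. f (x + a)) \<in> W)"

text \<open>Finite-dimensionality without bases: a linear space \<open>W\<close> embeds into the
  functions on the finite set \<open>P\<close>.\<close>

definition determining :: "'g set \<Rightarrow> ('g \<Rightarrow> complex) set \<Rightarrow> bool"
  where "determining P W \<longleftrightarrow> finite P \<and> (\<forall>f\<in>W. (\<forall>p\<in>P. f p = 0) \<longrightarrow> (\<forall>x. f x = 0))"

lemma translation_invariant_space_linear:
  "translation_invariant_space W \<Longrightarrow> f \<in> W \<Longrightarrow> g \<in> W \<Longrightarrow> (\<lambda>x. f x + c * g x) \<in> W"
  by (simp add: translation_invariant_space_def)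

lemma translation_invariant_space_translate:
  "translation_invariant_space W \<Longrightarrow> f \<in> W \<Longrightarrow> (\<lambda>x. f (x + a)) \<in> W"
  by (simp add: translation_invariant_space_def)

lemma determiningD:
  "determining P W \<Longrightarrow> f \<in> W \<Longrightarrow> (\<And>p. p \<in> P \<Longrightarrow> f p = 0) \<Longrightarrow> f x = 0"
  by (simp add: determining_def)

lemma translation_invariant_space_sum:
  assumes W: "translation_invariant_space W" and F: "\<And>p. p \<in> P \<Longrightarrow> F p \<in> W" and "W \<noteq> {}"
  shows "(\<lambda>x. \<Sum>p\<in>P. c p * F p x) \<in> W"
proof -
  note lin = translation_invariant_space_linear[OF W]
  obtain f where "f \<in> W" using \<open>W \<noteq> {}\<close> by blast
  from lin[OF this this, of "-1"] have "(\<lambda>x. 0) \<in> W" by simp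
  with F show ?thesis
  proof (induction P rule: infinite_finite_induct)
    case (insert p P)
    then show ?case using lin[of "\<lambda>x. \<Sum>p\<in>P. c p * F p x" "F p" "c p"] by (simp add: add.commute)
  qed auto
qed

text \<open>By minimality, dropping p leaves some nonzero function of \<open>W\<close> that vanishes
  on the rest of \<open>P\<close>. It cannot vanish at p, so it can be scaled to 1 there.\<close>

lemma determining_dual_basis:
  assumes W: "translation_invariant_space W" and P: "determining P W"
    and min: "\<And>Q. determining Q W \<Longrightarrow> card P \<le> card Q"
  obtains F where "\<And>p. p \<in> P \<Longrightarrow> F p \<in> W" "\<And>p q. p \<in> P \<Longrightarrow> q \<in> P \<Longrightarrow> F p q = (if p = q then 1 else 0)"
proof -
  have "\<exists>f\<in>W. \<forall>q\<in>P. f q = (if p = q then 1 else 0)" if p: "p \<in> P" for p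
  proof -
    have "finite P" using P by (simp add: determining_def)
    then have "card (P - {p}) < card P" using p by (rule card_Diff1_less)
    then have "\<not> determining (P - {p}) W" using min[of "P - {p}"] by linarith
    then obtain f where f: "f \<in> W" "\<And>q. q \<in> P - {p} \<Longrightarrow> f q = 0" "\<exists>x. f x \<noteq> 0"
      using \<open>finite P\<close> unfolding determining_def by auto
    have "f p \<noteq> 0"
    proof
      assume "f p = 0"
      with f(2) have "\<forall>q\<in>P. f q = 0" by auto
      with determiningD[OF P f(1)] f(3) show False by blast
    qed
    moreover have "(\<lambda>x. f x + (1 / f p - 1) * f x) \<in> W"
      by (rule translation_invariant_space_linear[OF W f(1) f(1)])
    ultimately show ?thesis
      using f(2) by (intro bexI[of _ "\<lambda>x. f x + (1 / f p - 1) * f x"]) (auto simp: algebra_simps)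
  qed
  then show thesis using that by metis
qed

lemma determining_unique:
  assumes W: "translation_invariant_space W" and P: "determining P W"
    and "f \<in> W" "g \<in> W" "\<And>p. p \<in> P \<Longrightarrow> f p = g p"
  shows "f = g"
proof -
  have "(\<lambda>x. f x + (-1) * g x) \<in> W"
    by (rule translation_invariant_space_linear[OF W assms(3,4)])
  from determiningD[OF P this] assms(5) have "f x + (-1) * g x = 0" for x by simp
  then show ?thesis by (intro ext) simp
qed

text \<open>The least cardinality of a determining set plays the role of the dimension.\<close>

lemma common_eigenfunction_exists:
  assumes V: "translation_invariant_space V" and nz: "f0 \<in> V" "f0 x0 \<noteq> 0" and P0: "determining P0 V"
  obtains w x where "w \<in> V" "w x \<noteq> 0" "\<And>a. \<exists>c. \<forall>x. w (x + a) = c * w x"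
proof -
  define good where "good = (\<lambda>(W, P). W \<subseteq> V \<and> translation_invariant_space W \<and>
    (\<exists>f\<in>W. \<exists>x. f x \<noteq> 0) \<and> determining P W)"
  have "good (V, P0)" using assms by (auto simp: good_def)
  \<comment> \<open>Minimality is over all pairs, so it covers other determining sets of
    \<open>W\<close> as well as the nonzero invariant subspaces of \<open>W\<close> that arise
    below.\<close>
  from ex_has_least_nat[where P=good and k="(V, P0)" and m="\<lambda>(W, P). card P", OF this]
  obtain W P where good: "good (W, P)" and least: "\<And>W' P'. good (W', P') \<Longrightarrow> card P \<le> card P'"
    by auto
  then have W: "W \<subseteq> V" "translation_invariant_space W" "determining P W"
    and "\<exists>f\<in>W. \<exists>x. f x \<noteq> 0"
    by (auto simp: good_def)
  then obtain w x where w: "w \<in> W" "w x \<noteq> 0" by blast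
  have "finite P" using W(3) by (simp add: determining_def)
  have "P \<noteq> {}" using W(3) w by (auto simp: determining_def)
  have min: "card P \<le> card Q" if "determining Q W" for Q
    using least[of W Q] good that by (auto simp: good_def)
  obtain F where F: "\<And>p. p \<in> P \<Longrightarrow> F p \<in> W"
    "\<And>p q. p \<in> P \<Longrightarrow> q \<in> P \<Longrightarrow> F p q = (if p = q then 1 else 0)"
    using determining_dual_basis[OF W(2,3) min] by metis
  have "\<exists>z. \<forall>x. w (x + a) = z * w x" for a
  proof -
    \<comment> \<open>The matrix of translation by a in the basis \<open>F\<close>: the translate of
      \<open>F q\<close> has coordinates \<open>F q (p + a)\<close>.\<close>
    obtain z v p where p: "p \<in> P" "v p \<noteq> 0"
      and ev: "\<And>p. p \<in> P \<Longrightarrow> (\<Sum>q\<in>P. F q (p + a) * v q) = z * v p"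
      using eigenvector_exists[OF \<open>finite P\<close> \<open>P \<noteq> {}\<close>, of "\<lambda>p q. F q (p + a)"] by metis
    define f where "f x = (\<Sum>q\<in>P. v q * F q x)" for x
    have "f \<in> W" unfolding f_def[abs_def]
      using w by (intro translation_invariant_space_sum W F) auto
    have f_P: "f p = v p" if "p \<in> P" for p
      using that F(2) \<open>finite P\<close> by (simp add: f_def if_distrib[of "\<lambda>c. _ * c"] sum.delta cong: if_cong)
    have "(\<lambda>x. f (x + a)) \<in> W" "(\<lambda>x. z * f x) \<in> W"
    proof -
      show "(\<lambda>x. f (x + a)) \<in> W"
        by (rule translation_invariant_space_translate[OF W(2) \<open>f \<in> W\<close>])
      have "(\<lambda>x. f x + (z - 1) * f x) \<in> W"
        by (rule translation_invariant_space_linear[OF W(2) \<open>f \<in> W\<close> \<open>f \<in> W\<close>])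
      then show "(\<lambda>x. z * f x) \<in> W" by (simp add: algebra_simps)
    qed
    moreover have "f (p + a) = z * f p" if "p \<in> P" for p
      using ev[OF that] f_P[OF that] by (simp add: f_def mult.commute)
    ultimately have f_eq: "(\<lambda>x. f (x + a)) = (\<lambda>x. z * f x)"
      by (intro determining_unique[OF W(2,3)])
    \<comment> \<open>The eigenspace of one translation is invariant under all of them because
      translations commute.\<close>
    define W1 where "W1 = {g\<in>W. \<forall>x. g (x + a) = z * g x}"
    have "W1 \<subseteq> W" by (auto simp: W1_def)
    have W1: "translation_invariant_space W1"
      unfolding translation_invariant_space_def
    proof (intro conjI ballI allI)
      fix g h c assume gh: "g \<in> W1" "h \<in> W1"
      then have "(\<lambda>x. g x + c * h x) \<in> W"
        using \<open>W1 \<subseteq> W\<close> by (intro translation_invariant_space_linear[OF W(2)]) auto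
      with gh show "(\<lambda>x. g x + c * h x) \<in> W1" by (simp add: W1_def algebra_simps)
    next
      fix g b assume g: "g \<in> W1"
      then have "(\<lambda>x. g (x + b)) \<in> W"
        using \<open>W1 \<subseteq> W\<close> by (intro translation_invariant_space_translate[OF W(2)]) auto
      moreover have "g (x + a + b) = z * g (x + b)" for x
      proof -
        have "x + a + b = x + b + a" by (simp add: add_ac)
        then show ?thesis using g by (simp only: W1_def mem_Collect_eq)
      qed
      ultimately show "(\<lambda>x. g (x + b)) \<in> W1" by (simp add: W1_def)
    qed
    have P1: "determining P W1" using W(3) \<open>W1 \<subseteq> W\<close> unfolding determining_def by blast
    have "f \<in> W1" using \<open>f \<in> W\<close> f_eq by (auto simp: W1_def dest: fun_cong)
    moreover have "f p \<noteq> 0" using f_P p by simp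
    ultimately have "\<exists>f\<in>W1. \<exists>x. f x \<noteq> 0" by blast
    \<comment> \<open>A nonzero invariant subspace cannot be determined by fewer points. So
      \<open>P\<close> has a dual basis inside \<open>W1\<close> too, every element of
      \<open>W\<close> is interpolated by it, and \<open>W1\<close> is all of
      \<open>W\<close>.\<close>
    then have min1: "card P \<le> card Q" if "determining Q W1" for Q
      using least[of W1 Q] \<open>W1 \<subseteq> W\<close> W(1) W1 that by (auto simp: good_def)
    obtain G where G: "\<And>p. p \<in> P \<Longrightarrow> G p \<in> W1"
      "\<And>p q. p \<in> P \<Longrightarrow> q \<in> P \<Longrightarrow> G p q = (if p = q then 1 else 0)"
      using determining_dual_basis[OF W1 P1 min1] by metis
    have "(\<lambda>x. \<Sum>p\<in>P. w p * G p x) \<in> W1"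
      using \<open>f \<in> W1\<close> by (intro translation_invariant_space_sum W1 G) auto
    moreover have "w = (\<lambda>x. \<Sum>p\<in>P. w p * G p x)"
    proof (rule determining_unique[OF W(2,3) w(1)])
      show "(\<lambda>x. \<Sum>p\<in>P. w p * G p x) \<in> W" using calculation \<open>W1 \<subseteq> W\<close> by blast
      show "w q = (\<Sum>p\<in>P. w p * G p q)" if "q \<in> P" for q
        using that G(2) \<open>finite P\<close> by (simp add: if_distrib[of "\<lambda>c. _ * c"] sum.delta cong: if_cong)
    qed
    ultimately have "w \<in> W1" by simp
    then show ?thesis by (auto simp: W1_def)
  qed
  with w W(1) show thesis by (intro that[of w x]) auto
qed

text \<open>A value of norm above 1 would have unbounded powers, which are again values. Applying
  this bound to x and -x gives equality.\<close>

lemma norm_one_if_bounded_hom: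
  fixes \<theta> :: "'g::ab_group_add \<Rightarrow> complex"
  assumes hom: "\<And>x y. \<theta> (x + y) = \<theta> x * \<theta> y" and "\<theta> 0 = 1" and B: "\<And>x. norm (\<theta> x) \<le> B"
  shows "norm (\<theta> x) = 1"
proof -
  have le: "norm (\<theta> a) \<le> 1" for a
  proof (rule ccontr)
    assume "\<not> norm (\<theta> a) \<le> 1"
    then have "1 < norm (\<theta> a)" by simp
    then obtain n where "B < norm (\<theta> a) ^ n" using real_arch_pow by blast
    moreover have "\<exists>b. \<theta> b = \<theta> a ^ n"
    proof (induction n)
      case 0
      then show ?case using \<open>\<theta> 0 = 1\<close> by auto
    next
      case (Suc n)
      then obtain b where "\<theta> b = \<theta> a ^ n" by blast
      then have "\<theta> (a + b) = \<theta> a ^ Suc n" by (simp add: hom)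
      then show ?case by blast
    qed
    ultimately show False using B by (metis norm_power not_le)
  qed
  have "\<theta> x * \<theta> (- x) = 1" using hom[of x "- x"] \<open>\<theta> 0 = 1\<close> by simp
  then have "norm (\<theta> x) * norm (\<theta> (- x)) = 1" by (metis norm_mult norm_one)
  moreover have "norm (\<theta> x) * norm (\<theta> (- x)) \<le> norm (\<theta> x) * 1"
    by (intro mult_left_mono le) auto
  ultimately show ?thesis using le[of x] by linarith
qed

section \<open>Characters in eigenspaces of convolution operators\<close>

context
  assumes X: "compact (UNIV :: 'a::topological_ab_group_add set)"
begin

text \<open>Convolution commutes with translations, so the eigenspace is invariant. It is
  finite-dimensional because \<mu> is positive: its elements f satisfy |f m - f b| \<le> sup |f| / 2
  whenever m - b is in a fixed neighbourhood of 0, so f vanishes once it vanishes on a finite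
  net.\<close>

lemma character_in_eigenspace:
  fixes k p :: "'a \<Rightarrow> real"
  assumes k: "continuous_on UNIV k" and "\<mu> > 0" and p: "continuous_on UNIV p" "p 0 \<noteq> 0"
    and eigen: "\<And>x. conv k p x = \<mu> * p x"
  obtains \<theta> :: "'a \<Rightarrow> complex" where "unitary_character \<theta>" "continuous_on UNIV \<theta>"
    "\<And>x. conv k \<theta> x = complex_of_real \<mu> * \<theta> x"
proof -
  define V where "V = {f :: 'a \<Rightarrow> complex. continuous_on UNIV f \<and> (\<forall>x. conv k f x = of_real \<mu> * f x)}"
  have V_mean: "has_mean (\<lambda>y. k (x - y) *\<^sub>R f y) (of_real \<mu> * f x)" if "f \<in> V" for f x
    using has_mean_conv[OF X k, of f x] that by (simp add: V_def)
  have V_I: "f \<in> V" if "continuous_on UNIV f" "\<And>x. has_mean (\<lambda>y. k (x - y) *\<^sub>R f y) (of_real \<mu> * f x)" for f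
    using that by (simp add: V_def conv_def mean_eqI)
  have inv: "translation_invariant_space V"
    unfolding translation_invariant_space_def
  proof (intro conjI ballI allI)
    fix f g c assume fg: "f \<in> V" "g \<in> V"
    show "(\<lambda>x. f x + c * g x) \<in> V"
    proof (rule V_I)
      show "continuous_on UNIV (\<lambda>x. f x + c * g x)"
        using fg by (intro continuous_intros) (simp_all add: V_def)
      show "has_mean (\<lambda>y. k (x - y) *\<^sub>R (f y + c * g y)) (of_real \<mu> * (f x + c * g x))" for x
        using has_mean_add[OF V_mean[OF fg(1)] has_mean_bounded_linear[OF V_mean[OF fg(2)] bounded_linear_mult_right], of x c]
        by (simp add: algebra_simps scaleR_conv_of_real)
    qed
  next
    fix f a assume f: "f \<in> V"
    show "(\<lambda>x. f (x + a)) \<in> V"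
    proof (rule V_I)
      show "continuous_on UNIV (\<lambda>x. f (x + a))"
        by (rule continuous_on_compose2[of UNIV f]) (use f in \<open>auto simp: V_def intro!: continuous_intros\<close>)
      show "has_mean (\<lambda>y. k (x - y) *\<^sub>R f (y + a)) (of_real \<mu> * f (x + a))" for x
        using has_mean_translate[OF V_mean[OF f, of "x + a"], of a] by simp
    qed
  qed
  have p_V: "(\<lambda>x. of_real (p x)) \<in> V"
  proof (rule V_I)
    show "continuous_on UNIV (\<lambda>x. complex_of_real (p x))" by (intro continuous_intros p)
    show "has_mean (\<lambda>y. k (x - y) *\<^sub>R complex_of_real (p y)) (of_real \<mu> * of_real (p x))" for x
      using has_mean_bounded_linear[OF has_mean_conv[OF X k p(1), of x] bounded_linear_of_real[where 'a = complex]]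
      by (simp add: eigen scaleR_conv_of_real)
  qed
  have "\<mu> / 2 > 0" using \<open>\<mu> > 0\<close> by simp
  from compact_group_uniformly_continuous[OF X k this]
  obtain U where U: "open U" "0 \<in> U" "\<forall>u\<in>U. \<forall>x. dist (k (x + u)) (k x) < \<mu> / 2" .
  obtain bs where bs: "bs \<noteq> []" "\<forall>x. \<exists>b\<in>set bs. x - b \<in> U"
    using compact_group_finite_cover[OF X U(1,2)] .
  have "determining (set bs) V"
    unfolding determining_def
  proof (intro conjI ballI allI impI)
    fix f x assume f: "f \<in> V" and zero: "\<forall>p\<in>set bs. f p = 0"
    have "continuous_on UNIV (\<lambda>x. norm (f x))"
      using f by (intro continuous_intros) (simp add: V_def)
    then obtain m where m: "\<And>x. norm (f x) \<le> norm (f m)"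
      using continuous_attains_sup[OF X, of "\<lambda>x. norm (f x)"] by auto
    obtain b where b: "b \<in> set bs" "m - b \<in> U" using bs(2) by blast
    \<comment> \<open>Here m is a point where |f| is maximal and b a nearby point of the net. The
      factor 1/2 is what makes f m vanish when f b does.\<close>
    have "norm (k (m - y) *\<^sub>R f y - k (b - y) *\<^sub>R f y) \<le> \<mu> / 2 * norm (f m)" for y
    proof -
      have "dist (k ((b - y) + (m - b))) (k (b - y)) < \<mu> / 2" using U(3) b(2) by blast
      then have "\<bar>k (m - y) - k (b - y)\<bar> * norm (f y) \<le> \<mu> / 2 * norm (f m)"
        using \<open>\<mu> > 0\<close> by (intro mult_mono m) (auto simp: dist_real_def algebra_simps)
      then show ?thesis by (simp flip: scaleR_diff_left)
    qed
    then have "norm (of_real \<mu> * f m - of_real \<mu> * f b) \<le> \<mu> / 2 * norm (f m)"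
      by (rule has_mean_norm_le[OF has_mean_diff[OF V_mean[OF f] V_mean[OF f]]])
    then have "\<mu> * norm (f m) \<le> \<mu> / 2 * norm (f m)"
      using zero b(1) \<open>\<mu> > 0\<close> by (simp add: norm_mult)
    then have "norm (f m) = 0" using \<open>\<mu> > 0\<close> by simp
    then show "f x = 0" using m[of x] by simp
  qed simp
  then obtain w x where w: "w \<in> V" "w x \<noteq> 0" "\<And>a. \<exists>c. \<forall>x. w (x + a) = c * w x"
    using common_eigenfunction_exists[OF inv p_V, of 0] p(2) by (metis of_real_eq_0_iff)
  have "w 0 \<noteq> 0"
  proof
    assume "w 0 = 0"
    then have "w (0 + x) = 0" using w(3)[of x] by (metis mult_zero_right)
    with w(2) show False by simp
  qed
  \<comment> \<open>The eigenvalue of translation by y on w is w y / w 0, as evaluation at 0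
    shows.\<close>
  define \<theta> where "\<theta> x = w x / w 0" for x
  have hom: "\<theta> (x + y) = \<theta> x * \<theta> y" for x y
  proof -
    obtain c where "\<forall>x. w (x + y) = c * w x" using w(3) by blast
    from spec[OF this, of x] spec[OF this, of 0] show ?thesis
      using \<open>w 0 \<noteq> 0\<close> by (simp add: \<theta>_def)
  qed
  have "continuous_on UNIV w" using w(1) by (simp add: V_def)
  then have cont: "continuous_on UNIV \<theta>"
    unfolding \<theta>_def[abs_def] using \<open>w 0 \<noteq> 0\<close> by (intro continuous_intros) auto
  obtain B where "\<And>x. norm (\<theta> x) \<le> B" using compact_UNIV_bounded[OF X cont] by metis
  then have "unitary_character \<theta>"
    unfolding unitary_character_def using hom \<open>w 0 \<noteq> 0\<close>
    by (intro conjI allI norm_one_if_bounded_hom[where B=B]) (auto simp: \<theta>_def)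
  moreover have "conv k \<theta> x = of_real \<mu> * \<theta> x" for x
    unfolding conv_def
    using has_mean_bounded_linear[OF V_mean[OF w(1), of x] bounded_linear_divide[of "w 0"]]
    by (intro mean_eqI) (simp add: \<theta>_def scaleR_conv_of_real)
  ultimately show thesis using cont that by blast
qed

end

section \<open>From eigenfunctions to separation of points\<close>

lemma compact_Hausdorff_Urysohn:
  fixes S T :: "'a::t2_space set"
  assumes "compact (UNIV :: 'a set)" "closed S" "closed T" "S \<inter> T = {}"
  obtains f :: "'a \<Rightarrow> real" where "continuous_on UNIV f" "\<forall>x\<in>S. f x = a" "\<forall>x\<in>T. f x = b"
proof -
  have "compact_space (euclidean :: 'a topology)"
    using assms(1) by (simp add: compact_space_def)
  moreover have "Hausdorff_space (euclidean :: 'a topology)"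
    unfolding Hausdorff_space_def disjnt_def using hausdorff by auto
  ultimately have "normal_space (euclidean :: 'a topology)"
    by (simp add: compact_Hausdorff_or_regular_imp_normal_space)
  then obtain f where "continuous_map euclidean euclideanreal f" "f ` S \<subseteq> {a}" "f ` T \<subseteq> {b}"
    by (rule Urysohn_lemma_alt[where S=S and T=T]) (use assms in \<open>auto simp: disjnt_def\<close>)
  then show thesis by (intro that[of f]) auto
qed

lemma character_separates:
  fixes x0 :: "'a::{topological_ab_group_add, t2_space}"
  assumes X: "compact (UNIV :: 'a set)" and "x0 \<noteq> 0"
  obtains \<theta> :: "'a \<Rightarrow> complex" where "unitary_character \<theta>" "continuous_on UNIV \<theta>" "\<theta> x0 \<noteq> 1"
proof -
  \<comment> \<open>Vanishing at both points survives the symmetrisation, so \<open>h 0\<close> is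
    1.\<close>
  have "closed {0::'a}" "closed {x0, - x0}" "{0} \<inter> {x0, - x0} = {}"
    using \<open>x0 \<noteq> 0\<close> by auto
  from compact_Hausdorff_Urysohn[OF X this, of 1 0]
  obtain f :: "'a \<Rightarrow> real" where f: "continuous_on UNIV f" "\<forall>x\<in>{0}. f x = 1" "\<forall>x\<in>{x0, - x0}. f x = 0" .
  define g where "g x = (f x + f (- x)) / 2" for x
  have g: "continuous_on UNIV g" "g 0 = 1" "g x0 = 0" "g (- x0) = 0" "\<And>x. g (- x) = g x"
    unfolding g_def[abs_def] using f
    by (auto intro!: continuous_intros continuous_on_compose2[OF f(1)] simp: add.commute)
  define h where "h x = g x - (g (x + x0) + g (x - x0)) / 2" for x
  have h_cont: "continuous_on UNIV h"
    unfolding h_def[abs_def]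
    by (auto intro!: continuous_intros continuous_on_compose2[OF g(1)])
  have h_even: "h (- x) = h x" for x
  proof -
    have "- x + x0 = - (x - x0)" "- x - x0 = - (x + x0)" by simp_all
    then show ?thesis by (simp only: h_def g(5) add.commute)
  qed
  have "h 0 \<noteq> 0" using g by (simp add: h_def)
  from conv_eigenfunction_exists[OF X h_cont h_even this]
  obtain \<mu> and p :: "'a \<Rightarrow> real" where \<mu>: "\<mu> > 0" and p: "continuous_on UNIV p" "p 0 \<noteq> 0"
    "\<And>x. conv (conv h h) p x = \<mu> * p x" by metis
  note k_cont = continuous_conv[OF X h_cont h_cont]
  obtain \<theta> :: "'a \<Rightarrow> complex" where \<theta>: "unitary_character \<theta>" "continuous_on UNIV \<theta>"
    and eigen: "\<And>x. conv (conv h h) \<theta> x = complex_of_real \<mu> * \<theta> x"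
    using character_in_eigenspace[OF X k_cont \<mu> p] by metis
  have hom: "\<theta> (x + y) = \<theta> x * \<theta> y" and norm1: "norm (\<theta> x) = 1" for x y
    using \<theta>(1) by (simp_all add: unitary_character_def)
  have "\<theta> 0 \<noteq> 0" using norm1[of 0] by auto
  have "\<theta> x0 \<noteq> 1"
  proof
    assume one: "\<theta> x0 = 1"
    have "\<theta> (- x0) = 1"
      using hom[of x0 "- x0"] hom[of 0 0] \<open>\<theta> 0 \<noteq> 0\<close> one by simp
    define G where "G = conv g h"
    have G_cont: "continuous_on UNIV G"
      unfolding G_def by (rule continuous_conv[OF X g(1) h_cont])
    \<comment> \<open>Expanding only the left factor already shows the kernel to be a second
      difference of step \<open>x0\<close>.\<close>
    have k: "conv h h x = G x - (G (x + x0) + G (x - x0)) / 2" for x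
    proof -
      have G: "has_mean (\<lambda>y. g (x + a - y) * h y) (G (x + a))" for a
        using has_mean_conv[OF X g(1) h_cont, of "x + a"] by (simp add: G_def)
      have "has_mean (\<lambda>y. g (x - y) * h y - (g (x + x0 - y) * h y + g (x - x0 - y) * h y) / 2)
          (G x - (G (x + x0) + G (x - x0)) / 2)"
        using has_mean_diff[OF G[of 0] has_mean_bounded_linear[OF has_mean_add[OF G[of x0] G[of "- x0"]]
            bounded_linear_divide[of 2]]] by simp
      moreover have "g (x - y) * h y - (g (x + x0 - y) * h y + g (x - x0 - y) * h y) / 2 = h (x - y) * h y" for y
      proof -
        have "x + x0 - y = x - y + x0" "x - x0 - y = x - y - x0" by simp_all
        then show ?thesis by (simp add: h_def[of "x - y"] field_simps)
      qed
      ultimately show ?thesis unfolding conv_def[of h] by (intro mean_eqI) simp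
    qed
    define c where "c = conv G \<theta> 0"
    have c: "has_mean (\<lambda>y. G (- y) *\<^sub>R \<theta> y) c"
      using has_mean_conv[OF X G_cont \<theta>(2), of 0] by (simp add: c_def)
    \<comment> \<open>Translating the mean by \<open>x0\<close> changes only \<open>G\<close>, since
      \<theta> has period \<open>x0\<close> when its value there is 1. The three terms of the second
      difference then cancel, against the positive eigenvalue.\<close>
    have "has_mean (\<lambda>y. G (- y - x0) *\<^sub>R \<theta> y) c"
      using has_mean_translate[OF c, of x0] by (simp add: hom one)
    moreover have "has_mean (\<lambda>y. G (- y + x0) *\<^sub>R \<theta> y) c"
      using has_mean_translate[OF c, of "- x0"] hom[of _ "- x0"] \<open>\<theta> (- x0) = 1\<close> by (simp add: add.commute)
    ultimately have "has_mean (\<lambda>y. (G (- y) *\<^sub>R \<theta> y) - (1 / 2) *\<^sub>R (G (- y + x0) *\<^sub>R \<theta> y + G (- y - x0) *\<^sub>R \<theta> y))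
        (c - (1 / 2) *\<^sub>R (c + c))"
      by (intro has_mean_diff[OF c] has_mean_bounded_linear[OF _ bounded_linear_scaleR_right] has_mean_add)
    moreover have "(G (- y) *\<^sub>R \<theta> y) - (1 / 2) *\<^sub>R (G (- y + x0) *\<^sub>R \<theta> y + G (- y - x0) *\<^sub>R \<theta> y)
        = conv h h (0 - y) *\<^sub>R \<theta> y" for y
      by (simp add: k scaleR_conv_of_real field_simps)
    ultimately have "has_mean (\<lambda>y. conv h h (0 - y) *\<^sub>R \<theta> y) 0"
      by (simp add: scaleR_conv_of_real)
    then have "conv (conv h h) \<theta> 0 = 0" unfolding conv_def[of _ \<theta>] by (rule mean_eqI)
    then show False using eigen[of 0] \<mu> \<open>\<theta> 0 \<noteq> 0\<close> by simp
  qed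
  then show thesis using \<theta> that by blast
qed

subsection \<open>Means of characters of an abstract abelian group\<close>

text \<open>The averages over 0, a, ..., (n-1) a are geometric sums divided by n, bounded by 2 / (n
  |\<theta> a - 1|) uniformly in x.\<close>

lemma unitary_character_has_mean_0:
  assumes "unitary_character \<theta>" "\<theta> a \<noteq> 1"
  shows "has_mean \<theta> 0"
  unfolding has_mean_def
proof (intro allI impI)
  fix \<epsilon> :: real assume "\<epsilon> > 0"
  have hom: "\<theta> (x + y) = \<theta> x * \<theta> y" and norm1: "norm (\<theta> x) = 1" for x y
    using assms(1) by (simp_all add: unitary_character_def)
  define d where "d = norm (\<theta> a - 1)"
  have "d > 0" using assms(2) by (simp add: d_def)
  obtain n :: nat where n_gt: "2 / (d * \<epsilon>) < n" using reals_Archimedean2 by blast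
  have "2 / (d * \<epsilon>) > 0" using \<open>d > 0\<close> \<open>\<epsilon> > 0\<close> by simp
  with n_gt have "real n > 0" by linarith
  moreover have "2 / d \<le> \<epsilon> * n"
    using n_gt \<open>d > 0\<close> \<open>\<epsilon> > 0\<close> by (simp add: field_simps)
  ultimately have n: "n > 0" "2 / d \<le> \<epsilon> * n" by simp_all
  let ?as = "map (\<lambda>i. ((+) a ^^ i) 0) [0..<n]"
  have "norm (avg ?as \<theta> x - 0) \<le> \<epsilon>" for x
  proof -
    have pow: "\<theta> (x + ((+) a ^^ i) 0) = \<theta> x * \<theta> a ^ i" for i
    proof (induction i)
      case (Suc i)
      have "x + ((+) a ^^ Suc i) 0 = a + (x + ((+) a ^^ i) 0)" by (simp add: add_ac)
      then show ?case using Suc by (simp only: hom[of a]) (simp add: mult_ac)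
    qed simp
    have "avg ?as \<theta> x = (\<Sum>i\<in>{0..<n}. \<theta> x * \<theta> a ^ i) /\<^sub>R n"
      by (simp add: avg_def o_def pow interv_sum_list_conv_sum_set_nat)
    also have "(\<Sum>i\<in>{0..<n}. \<theta> x * \<theta> a ^ i) = \<theta> x * ((\<theta> a ^ n - 1) / (\<theta> a - 1))"
      using assms(2) by (simp add: geometric_sum sum_distrib_left[symmetric] lessThan_atLeast0[symmetric])
    finally have "norm (avg ?as \<theta> x) = norm (\<theta> a ^ n - 1) / d / n"
      by (simp add: norm_mult norm_divide norm1 d_def divide_inverse norm_inverse mult_ac)
    also have "norm (\<theta> a ^ n - 1) \<le> 2"
      using norm_triangle_ineq4[of "\<theta> a ^ n" 1] by (simp add: norm_power norm1)
    then have "norm (\<theta> a ^ n - 1) / d / n \<le> 2 / d / n"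
      using \<open>d > 0\<close> by (intro divide_right_mono) auto
    also have "\<dots> \<le> \<epsilon>" using n \<open>d > 0\<close> by (simp add: field_simps)
    finally show ?thesis by simp
  qed
  then show "\<exists>as. as \<noteq> [] \<and> (\<forall>x. norm (avg as \<theta> x - 0) \<le> \<epsilon>)"
    using n(1) by (intro exI[of _ ?as]) auto
qed

text \<open>Total boundedness without topology on the group: the values of finitely many characters
  lie in a bounded region, which meets finitely many cells of a grid. One representative per
  occupied cell suffices.\<close>

lemma characters_finite_cover:
  fixes F :: "('g::ab_group_add \<Rightarrow> complex) set"
  assumes F: "finite F" "\<And>f. f \<in> F \<Longrightarrow> unitary_character f" and "\<eta> > 0"
  obtains bs where "bs \<noteq> []" "\<forall>x. \<exists>b\<in>set bs. \<forall>f\<in>F. norm (f (x - b) - 1) < \<eta>"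
proof -
  \<comment> \<open>Within a cell the real and imaginary parts each differ by less than r.\<close>
  define r where "r = \<eta> / 2"
  have "r > 0" using \<open>\<eta> > 0\<close> by (simp add: r_def)
  define m where "m = \<lceil>1 / r\<rceil>"
  define c where "c x = restrict (\<lambda>f. (\<lfloor>Re (f x) / r\<rfloor>, \<lfloor>Im (f x) / r\<rfloor>)) F" for x :: 'g
  have floor_bound: "\<lfloor>t / r\<rfloor> \<in> {-m..m}" if "\<bar>t\<bar> \<le> 1" for t :: real
  proof -
    have "t / r \<le> 1 / r" "- (1 / r) \<le> t / r"
      using that \<open>r > 0\<close> by (auto simp: field_simps abs_le_iff)
    moreover have "1 / r \<le> of_int m" by (simp add: m_def)
    ultimately have "t / r \<le> of_int m" "of_int (- m) \<le> t / r" by simp_all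
    then show ?thesis by (simp add: le_floor_iff floor_le_iff)
  qed
  have "range c \<subseteq> F \<rightarrow>\<^sub>E {-m..m} \<times> {-m..m}"
  proof
    fix y assume "y \<in> range c"
    then obtain x where y: "y = c x" by blast
    have "\<bar>Re (f x)\<bar> \<le> 1" "\<bar>Im (f x)\<bar> \<le> 1" if "f \<in> F" for f
      using F(2)[OF that] abs_Re_le_cmod[of "f x"] abs_Im_le_cmod[of "f x"]
      by (simp_all add: unitary_character_def)
    then show "y \<in> F \<rightarrow>\<^sub>E {-m..m} \<times> {-m..m}"
      unfolding y c_def using floor_bound by auto
  qed
  then have "finite (range c)"
    by (rule finite_subset) (intro finite_PiE F(1), simp)
  then obtain bs where bs: "set bs = inv_into UNIV c ` range c" using finite_list[of "inv_into UNIV c ` range c"] by auto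
  have "bs \<noteq> []" using bs by auto
  moreover have "\<exists>b\<in>set bs. \<forall>f\<in>F. norm (f (x - b) - 1) < \<eta>" for x
  proof (intro bexI ballI)
    let ?b = "inv_into UNIV c (c x)"
    show "?b \<in> set bs" using bs by auto
    fix f assume f: "f \<in> F"
    have hom: "f (x + y) = f x * f y" and norm1: "norm (f x) = 1" for x y
      using F(2)[OF f] by (simp_all add: unitary_character_def)
    have "c ?b = c x" by (rule f_inv_into_f) simp
    from fun_cong[OF this, of f] f
    have "\<lfloor>Re (f ?b) / r\<rfloor> = \<lfloor>Re (f x) / r\<rfloor>" "\<lfloor>Im (f ?b) / r\<rfloor> = \<lfloor>Im (f x) / r\<rfloor>"
      by (simp_all add: c_def)
    then have "\<bar>Re (f x) / r - Re (f ?b) / r\<bar> < 1" "\<bar>Im (f x) / r - Im (f ?b) / r\<bar> < 1"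
      by linarith+
    then have "\<bar>Re (f x - f ?b)\<bar> < r" "\<bar>Im (f x - f ?b)\<bar> < r"
      using \<open>r > 0\<close> by (simp_all flip: diff_divide_distrib)
    then have "norm (f x - f ?b) < \<eta>"
      using cmod_le[of "f x - f ?b"] by (simp add: r_def)
    moreover have "f x - f ?b = (f (x - ?b) - 1) * f ?b"
      using hom[of "x - ?b" ?b] by (simp add: algebra_simps)
    ultimately show "norm (f (x - ?b) - 1) < \<eta>" by (simp add: norm_mult norm1)
  qed
  ultimately show thesis using that by blast
qed

lemma avg_real_eq: "avg as f x = (\<Sum>a\<leftarrow>as. f (x + a)) / real (length as)" for f :: "_ \<Rightarrow> real"
  by (simp add: avg_def divide_inverse mult.commute)

lemma not_power_le_const_mult_power:
  fixes s \<delta> :: real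
  assumes "0 < \<delta>" "\<delta> < s"
  shows "\<exists>N. C * \<delta> ^ N < s ^ N"
proof -
  obtain N where "C < (s / \<delta>) ^ N" using real_arch_pow[of "s / \<delta>" C] assms by auto
  then have "C * \<delta> ^ N < s ^ N" using assms by (simp add: power_divide field_simps)
  then show ?thesis ..
qed

text \<open>The kernel \<open>\<Prod>\<^sub>f ((1 + Re f) / 2) ^ N\<close> is a linear combination of characters in
  \<open>\<Lambda>\<close> and concentrates near the common kernel of \<open>F\<close> as \<open>N\<close> grows. If \<open>\<psi>\<close>
  were not in \<open>\<Lambda>\<close>, the mean of the kernel times \<open>\<psi>\<close> would vanish.\<close>

lemma character_in_group_if_Re_ge:
  fixes \<Lambda> F :: "('g::ab_group_add \<Rightarrow> complex) set"
  assumes \<Lambda>: "\<And>f. f \<in> \<Lambda> \<Longrightarrow> unitary_character f" "(\<lambda>x. 1) \<in> \<Lambda>"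
      "\<And>f g. f \<in> \<Lambda> \<Longrightarrow> g \<in> \<Lambda> \<Longrightarrow> (\<lambda>x. f x * g x) \<in> \<Lambda>" "\<And>f. f \<in> \<Lambda> \<Longrightarrow> (\<lambda>x. cnj (f x)) \<in> \<Lambda>"
    and F: "finite F" "F \<subseteq> \<Lambda>" and \<psi>: "unitary_character \<psi>" and "\<epsilon> > 0"
    and near: "\<And>x. \<forall>f\<in>F. norm (f x - 1) < \<epsilon> \<Longrightarrow> Re (\<psi> x) \<ge> 1 / 2"
  shows "\<psi> \<in> \<Lambda>"
proof (rule ccontr)
  assume "\<psi> \<notin> \<Lambda>"
  define k where "k x = (\<Prod>f\<in>F. (1 + Re (f x)) / 2)" for x
  \<comment> \<open>Quantifying over all g in \<Lambda> makes this stable under a factor (1 + Re h)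
    / 2 = 1/2 + (h + cnj h)/4, whose characters are absorbed into g.\<close>
  define Q where "Q f \<longleftrightarrow> (\<forall>g\<in>\<Lambda>. has_mean (\<lambda>x. complex_of_real (f x) * g x * \<psi> x) 0)" for f
  have norm1: "norm (f x) = 1" if "f \<in> \<Lambda>" for f x
    using \<Lambda>(1)[OF that] by (simp add: unitary_character_def)
  have Q_1: "Q (\<lambda>x. 1)"
    unfolding Q_def
  proof
    fix g assume g: "g \<in> \<Lambda>"
    have "unitary_character (\<lambda>x. g x * \<psi> x)"
      using \<Lambda>(1)[OF g] \<psi> by (simp add: unitary_character_def norm_mult)
    moreover have "\<exists>a. g a * \<psi> a \<noteq> 1"
    proof (rule ccontr)
      assume "\<not> ?thesis"
      then have one: "g a * \<psi> a = 1" for a by blast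
      have "\<psi> a = cnj (g a)" for a
      proof -
        have "cnj (g a) * (g a * \<psi> a) = (g a * cnj (g a)) * \<psi> a" by (simp add: mult_ac)
        then show ?thesis using norm1[OF g, of a] one[of a] by (simp add: complex_norm_square[symmetric])
      qed
      then have "\<psi> = (\<lambda>x. cnj (g x))" by (intro ext)
      with \<Lambda>(4)[OF g] \<open>\<psi> \<notin> \<Lambda>\<close> show False by simp
    qed
    ultimately show "has_mean (\<lambda>x. complex_of_real 1 * g x * \<psi> x) 0"
      using unitary_character_has_mean_0 by fastforce
  qed
  have Q_mult: "Q (\<lambda>x. f x * ((1 + Re (h x)) / 2))" if "Q f" "h \<in> \<Lambda>" for f h
    unfolding Q_def
  proof
    fix g assume g: "g \<in> \<Lambda>"
    let ?m = "\<lambda>g x. complex_of_real (f x) * g x * \<psi> x"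
    have "has_mean (?m g) 0" "has_mean (?m (\<lambda>x. h x * g x)) 0" "has_mean (?m (\<lambda>x. cnj (h x) * g x)) 0"
      using \<open>Q f\<close> g \<Lambda>(3,4) \<open>h \<in> \<Lambda>\<close> by (auto simp: Q_def)
    then have "has_mean (\<lambda>x. 1 / 2 * ?m g x + (1 / 4 * ?m (\<lambda>x. h x * g x) x + 1 / 4 * ?m (\<lambda>x. cnj (h x) * g x) x))
        (1 / 2 * 0 + (1 / 4 * 0 + 1 / 4 * 0))"
      by (intro has_mean_add has_mean_bounded_linear[OF _ bounded_linear_mult_right])
    moreover have "1 / 2 * ?m g x + (1 / 4 * ?m (\<lambda>x. h x * g x) x + 1 / 4 * ?m (\<lambda>x. cnj (h x) * g x) x)
        = complex_of_real (f x * ((1 + Re (h x)) / 2)) * g x * \<psi> x" for x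
    proof -
      have "complex_of_real (Re (h x)) = (h x + cnj (h x)) / 2" by (simp add: complex_add_cnj)
      then have "complex_of_real (f x * ((1 + Re (h x)) / 2))
          = complex_of_real (f x) * (1 / 2 + (h x + cnj (h x)) / 4)"
        by (simp add: add_divide_distrib)
      then show ?thesis by (simp only:) (simp add: algebra_simps)
    qed
    ultimately show "has_mean (\<lambda>x. complex_of_real (f x * ((1 + Re (h x)) / 2)) * g x * \<psi> x) 0"
      by (simp only: mult_zero_right add_0_left)
  qed
  have Q_prod: "Q (\<lambda>x. f x * (\<Prod>h\<in>G. (1 + Re (h x)) / 2))" if "Q f" "finite G" "G \<subseteq> \<Lambda>" for f G
    using that(2,3)
  proof (induction G)
    case (insert h G)
    then have "Q (\<lambda>x. (f x * (\<Prod>h\<in>G. (1 + Re (h x)) / 2)) * ((1 + Re (h x)) / 2))"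
      by (intro Q_mult) auto
    with insert(1,2) show ?case by (simp add: mult_ac)
  qed (use that in simp)
  have Q_k: "Q (\<lambda>x. k x ^ N)" for N
  proof (induction N)
    case (Suc N)
    from Q_prod[OF this F] show ?case by (simp add: k_def mult.commute)
  qed (simp add: Q_1)
  have mean0: "has_mean (\<lambda>x. k x ^ N * Re (\<psi> x)) 0" for N
  proof -
    have "has_mean (\<lambda>x. complex_of_real (k x ^ N) * 1 * \<psi> x) 0" 
      using bspec[OF Q_k[unfolded Q_def] \<Lambda>(2)] .
    from has_mean_bounded_linear[OF this bounded_linear_Re] show ?thesis by simp
  qed
  have factor: "0 \<le> (1 + Re (f x)) / 2" "(1 + Re (f x)) / 2 \<le> 1" if "f \<in> F" for f x
    using abs_Re_le_cmod[of "f x"] norm1[of f x] F(2) that by auto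
  have k_nonneg: "0 \<le> k x" for x unfolding k_def by (intro prod_nonneg factor)
  \<comment> \<open>On the unit circle |z - 1|^2 = 2 - 2 Re z, which turns distance \<epsilon> into
    a factor at most 1 - \<epsilon>^2/4. The maximum keeps \<delta> positive for large
    \<epsilon>.\<close>
  define \<delta> where "\<delta> = max (1 / 2) (1 - \<epsilon>\<^sup>2 / 4)"
  have \<delta>: "0 < \<delta>" "\<delta> < 1" using \<open>\<epsilon> > 0\<close> by (auto simp: \<delta>_def)
  have far: "k x \<le> \<delta>" if "f \<in> F" "norm (f x - 1) \<ge> \<epsilon>" for f x
  proof -
    have "\<epsilon>\<^sup>2 \<le> (norm (f x - 1))\<^sup>2" using that \<open>\<epsilon> > 0\<close> by (intro power_mono) auto
    also have "\<dots> = (norm (f x))\<^sup>2 - 2 * Re (f x) + 1"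
      unfolding cmod_power2 by (simp add: power2_eq_square algebra_simps)
    also have "\<dots> = 2 - 2 * Re (f x)" using norm1[of f x] that F(2) by auto
    finally have "(1 + Re (f x)) / 2 \<le> 1 - \<epsilon>\<^sup>2 / 4" by simp
    then have "(1 + Re (f x)) / 2 \<le> \<delta>" unfolding \<delta>_def by (rule max.coboundedI2)
    have "k x = (1 + Re (f x)) / 2 * (\<Prod>g\<in>F - {f}. (1 + Re (g x)) / 2)"
      unfolding k_def using F(1) that(1) by (rule prod.remove)
    also have "\<dots> \<le> (1 + Re (f x)) / 2 * 1"
      using factor that(1) by (intro mult_left_mono prod_le_1) auto
    finally show ?thesis using \<open>(1 + Re (f x)) / 2 \<le> \<delta>\<close> by simp
  qed
  \<comment> \<open>Away from the kernel only -k^N bounds the right side from below; there k^N is at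
    most \<delta>^N, and 3/2 of it makes up for the difference to k^N / 2.\<close>
  have pointwise: "k x ^ N / 2 - 3 / 2 * \<delta> ^ N \<le> k x ^ N * Re (\<psi> x)" for x N
  proof (cases "\<forall>f\<in>F. norm (f x - 1) < \<epsilon>")
    case True
    from near[OF this] have "k x ^ N * (1 / 2) \<le> k x ^ N * Re (\<psi> x)"
      using k_nonneg by (intro mult_left_mono) auto
    moreover have "\<delta> ^ N \<ge> 0" using \<delta> by simp
    ultimately show ?thesis by simp
  next
    case False
    then have "k x \<le> \<delta>" using far by (auto simp: not_less)
    then have "k x ^ N \<le> \<delta> ^ N" using k_nonneg by (intro power_mono)
    moreover have "k x ^ N * (- 1) \<le> k x ^ N * Re (\<psi> x)"
      using k_nonneg abs_Re_le_cmod[of "\<psi> x"] \<psi>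
      by (intro mult_left_mono) (auto simp: unitary_character_def abs_le_iff)
    ultimately show ?thesis by simp
  qed
  \<comment> \<open>Any s strictly between \<delta> and 1 would do. By Bernoulli's inequality \<eta>
    is small enough for the product of card F factors to stay above s; the added 1 covers empty
    F.\<close>
  define s where "s = (1 + \<delta>) / 2"
  define \<eta> where "\<eta> = (1 - s) / (card F + 1)"
  have s: "\<delta> < s" "s < 1" using \<delta> by (simp_all add: s_def)
  have "\<eta> > 0" using s by (simp add: \<eta>_def)
  have "\<eta> \<le> 1 - s" unfolding \<eta>_def using s by (simp add: divide_le_eq)
  then have "\<eta> \<le> 1" using s \<delta> by linarith
  obtain bs where bs: "bs \<noteq> []" "\<forall>x. \<exists>b\<in>set bs. \<forall>f\<in>F. norm (f (x - b) - 1) < \<eta>"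
    using characters_finite_cover[OF F(1) _ \<open>\<eta> > 0\<close>] \<Lambda>(1) F(2) by (metis subsetD)
  have k_large: "s \<le> k x" if "\<forall>f\<in>F. norm (f x - 1) < \<eta>" for x
  proof -
    have "1 - \<eta> \<le> (1 + Re (f x)) / 2" if "f \<in> F" for f
      using \<open>\<forall>f\<in>F. norm (f x - 1) < \<eta>\<close> that abs_Re_le_cmod[of "f x - 1"] \<open>\<eta> > 0\<close>
      by (fastforce simp: abs_le_iff)
    then have "(1 - \<eta>) ^ card F \<le> k x"
      unfolding k_def prod_constant[symmetric] using \<open>\<eta> \<le> 1\<close> by (intro prod_mono) auto
    moreover have "1 + card F * (- \<eta>) \<le> (1 + - \<eta>) ^ card F"
      using \<open>\<eta> \<le> 1\<close> by (intro Bernoulli_inequality) simp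
    moreover have "card F * \<eta> \<le> 1 - s"
    proof -
      have "\<eta> * (1 + real (card F)) = 1 - s" by (simp add: \<eta>_def)
      with \<open>\<eta> > 0\<close> show ?thesis by (simp add: distrib_left mult.commute)
    qed
    ultimately show ?thesis by simp
  qed
  let ?J = "length bs" and ?bs = "map uminus bs"
  \<comment> \<open>At every x one of the J translates falls where the kernel is at least s, so the
    average of k^N is at least s^N / J, while the mean against \<psi> is 0. As s > \<delta>, large N
    refutes the inequality.\<close>
  have "s ^ N \<le> 3 * ?J * \<delta> ^ N" for N
  proof -
    let ?g = "\<lambda>x. k x ^ N / 2 - 3 / 2 * \<delta> ^ N"
    have "has_mean (avg ?bs (\<lambda>x. k x ^ N * Re (\<psi> x))) 0"
      using bs(1) mean0 by (simp add: has_mean_avg_iff)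
    moreover have "s ^ N / 2 / ?J - 3 / 2 * \<delta> ^ N \<le> avg ?bs (\<lambda>x. k x ^ N * Re (\<psi> x)) x" for x
    proof -
      obtain b where b: "b \<in> set bs" "\<forall>f\<in>F. norm (f (x - b) - 1) < \<eta>" using bs(2) by blast
      have "s ^ N / 2 \<le> k (x - b) ^ N / 2"
        using k_large[OF b(2)] s \<delta> by (intro divide_right_mono power_mono) auto
      also have "\<dots> \<le> (\<Sum>b\<leftarrow>bs. k (x - b) ^ N / 2)"
        using b(1) k_nonneg by (intro nonneg_member_le_sum_list[of b bs "\<lambda>b. k (x - b) ^ N / 2"]) auto
      finally have "s ^ N / 2 / ?J \<le> (\<Sum>b\<leftarrow>bs. k (x - b) ^ N / 2) / ?J"
        by (rule divide_right_mono) simp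
      also have "\<dots> = avg ?bs (\<lambda>x. k x ^ N / 2) x"
        by (simp add: avg_real_eq o_def)
      finally have "s ^ N / 2 / ?J - 3 / 2 * \<delta> ^ N \<le> avg ?bs ?g x"
        using bs(1) by (simp add: avg_diff avg_const)
      also have "\<dots> \<le> avg ?bs (\<lambda>x. k x ^ N * Re (\<psi> x)) x"
        unfolding avg_def using pointwise by (intro scaleR_left_mono sum_list_mono) auto
      finally show ?thesis .
    qed
    ultimately have "s ^ N / 2 / ?J - 3 / 2 * \<delta> ^ N \<le> 0"
      using has_mean_mono[OF has_mean_const] by blast
    then show ?thesis using bs(1) by (simp add: field_simps)
  qed
  then show False using not_power_le_const_mult_power[OF \<delta>(1) s(1)] by (meson not_le)
qed

subsection \<open>The dual group\<close>

lift_definition circle_exp :: "circle \<Rightarrow> complex" is "\<lambda>t. cis (2 * pi * t)"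
proof -
  fix x y assume "int_congruent x y"
  then obtain n where "x - y = of_int n" by (auto simp: int_congruent_def elim: Ints_cases)
  then have "x = y + of_int n" by simp
  then have "2 * pi * x = 2 * pi * y + 2 * pi * of_int n" by (simp only: distrib_left)
  moreover have "cis (2 * pi * of_int n) = 1" by (rule cis_multiple_2pi) simp
  ultimately show "cis (2 * pi * x) = cis (2 * pi * y)" by (simp flip: cis_mult)
qed

lemma circle_exp_add: "circle_exp (a + b) = circle_exp a * circle_exp b"
  by transfer (simp add: cis_mult algebra_simps)

lemma norm_circle_exp [simp]: "norm (circle_exp a) = 1"
  by transfer simp

lemma circle_exp_0 [simp]: "circle_exp 0 = 1"
  by transfer simp

lemma circle_exp_uminus: "circle_exp (- a) = cnj (circle_exp a)"
  by transfer (simp add: cis_cnj)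

lemma circle_exp_eq_1_iff: "circle_exp a = 1 \<longleftrightarrow> a = 0"
proof (transfer fixing: )
  fix t :: real
  have "cis (2 * pi * t) = 1 \<longleftrightarrow> (\<exists>n::int. t = of_int n)"
    by (simp add: cis_conv_exp exp_eq_1 mult.commute[of _ pi])
  then show "(cis (2 * pi * t) = 1) = int_congruent t 0"
    by (auto simp: int_congruent_def elim: Ints_cases)
qed

lemma inj_circle_exp: "inj circle_exp"
proof (rule injI)
  fix a b assume "circle_exp a = circle_exp b"
  then have "circle_exp (a - b) * circle_exp b = 1 * circle_exp b"
    by (simp flip: circle_exp_add)
  moreover have "circle_exp b \<noteq> 0" using norm_circle_exp[of b] by (metis norm_zero zero_neq_one)
  ultimately show "a = b" by (simp add: circle_exp_eq_1_iff)
qed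

lemma continuous_circle_exp: "continuous_on UNIV circle_exp"
proof -
  have "continuous_on UNIV (\<lambda>t. circle_exp (to_circle t))"
    unfolding circle_exp.abs_eq by (intro continuous_intros)
  then show ?thesis
    by (simp add: continuous_on_open_vimage open_circle_def vimage_def)
qed

lemma range_circle_exp: "range circle_exp = sphere 0 1"
proof
  show "sphere 0 1 \<subseteq> range circle_exp"
  proof
    fix z :: complex assume "z \<in> sphere 0 1"
    then have "z = cis (2 * pi * (Arg z / (2 * pi)))"
      using rcis_cmod_Arg[of z] by (simp add: rcis_def)
    then have "z = circle_exp (to_circle (Arg z / (2 * pi)))" by (simp add: circle_exp.abs_eq)
    then show "z \<in> range circle_exp" by blast
  qed
qed auto

lemma compact_circle: "compact (UNIV :: circle set)"
proof -
  have "a \<in> to_circle ` {0..1}" for a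
  proof -
    obtain t where t: "a = to_circle t" using surj_to_circle by (metis surjD)
    have "to_circle t = to_circle (frac t)" by (simp add: to_circle_eq_iff frac_def)
    moreover have "frac t \<in> {0..1}" using frac_lt_1[of t] by (simp add: less_imp_le)
    ultimately show ?thesis using t by blast
  qed
  then have eq: "UNIV = to_circle ` {0..1}" by blast
  show ?thesis
    by (subst eq) (rule compact_continuous_image[OF continuous_to_circle compact_Icc])
qed

text \<open>A continuous injection of a compact space into a Hausdorff space is a homeomorphism onto
  its image.\<close>

lemma continuous_inv_circle_exp: "continuous_on (sphere 0 1) (inv_into UNIV circle_exp)"
  using continuous_on_inv[OF continuous_circle_exp compact_circle, of "inv_into UNIV circle_exp"]
    inj_circle_exp by (simp add: range_circle_exp)

lemma inv_circle_exp: "norm z = 1 \<Longrightarrow> circle_exp (inv_into UNIV circle_exp z) = z"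
  by (rule f_inv_into_f) (simp add: range_circle_exp)

lemma tendsto_circle_exp_iff: "(\<lambda>n. circle_exp (a n)) \<longlonglongrightarrow> 1 \<longleftrightarrow> a \<longlonglongrightarrow> 0"
proof
  assume "a \<longlonglongrightarrow> 0"
  then show "(\<lambda>n. circle_exp (a n)) \<longlonglongrightarrow> 1"
    using continuous_on_tendsto_compose[OF continuous_circle_exp, of a 0] by simp
next
  assume "(\<lambda>n. circle_exp (a n)) \<longlonglongrightarrow> 1"
  then have "(\<lambda>n. inv_into UNIV circle_exp (circle_exp (a n))) \<longlonglongrightarrow> inv_into UNIV circle_exp 1"
    by (intro continuous_on_tendsto_compose[OF continuous_inv_circle_exp]) auto
  moreover have "inv_into UNIV circle_exp 1 = 0"
    using inv_f_f[OF inj_circle_exp, of 0] by simp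
  ultimately show "a \<longlonglongrightarrow> 0" by (simp add: inv_f_f[OF inj_circle_exp])
qed

text \<open>A type of its own, because means are taken over instances of
  \<open>ab_group_add\<close>; it carries no topology.\<close>

typedef (overloaded) ('a::topological_ab_group_add) dual = "characters :: ('a \<Rightarrow> circle) set"
  by (intro exI[of _ "\<lambda>_. 0"]) (simp add: characters_def)

setup_lifting type_definition_dual

instantiation dual :: (topological_ab_group_add) ab_group_add
begin

lift_definition zero_dual :: "'a dual" is "\<lambda>_. 0"
  by (simp add: characters_def)

lift_definition plus_dual :: "'a dual \<Rightarrow> 'a dual \<Rightarrow> 'a dual" is "\<lambda>f g x. f x + g x"
  by (auto simp: characters_def intro!: continuous_intros)

lift_definition uminus_dual :: "'a dual \<Rightarrow> 'a dual" is "\<lambda>f x. - f x"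
  by (auto simp: characters_def intro!: continuous_intros)

lift_definition minus_dual :: "'a dual \<Rightarrow> 'a dual \<Rightarrow> 'a dual" is "\<lambda>f g x. f x - g x"
  by (auto simp: characters_def intro!: continuous_intros)

instance by standard (transfer; simp add: fun_eq_iff algebra_simps)+

end

lemma characters_separate:
  fixes x :: "'a::{topological_ab_group_add, t2_space}"
  assumes X: "compact (UNIV :: 'a set)" and "x \<noteq> 0"
  obtains \<phi> where "\<phi> \<in> characters" "\<phi> x \<noteq> 0"
proof -
  obtain \<theta> :: "'a \<Rightarrow> complex" where \<theta>: "unitary_character \<theta>" "continuous_on UNIV \<theta>" "\<theta> x \<noteq> 1"
    using character_separates[OF assms] .
  define \<phi> where "\<phi> y = inv_into UNIV circle_exp (\<theta> y)" for y
  have exp: "circle_exp (\<phi> y) = \<theta> y" for y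
    using \<theta>(1) by (simp add: \<phi>_def inv_circle_exp unitary_character_def)
  have "continuous_on UNIV \<phi>"
    unfolding \<phi>_def[abs_def] using \<theta>
    by (intro continuous_on_compose2[OF continuous_inv_circle_exp]) (auto simp: unitary_character_def)
  moreover have "\<phi> (y + z) = \<phi> y + \<phi> z" for y z
    using \<theta>(1) by (intro injD[OF inj_circle_exp]) (simp add: circle_exp_add exp unitary_character_def)
  moreover have "\<phi> x \<noteq> 0" using exp[of x] \<theta>(3) by auto
  ultimately show thesis by (intro that[of \<phi>]) (auto simp: characters_def)
qed

section \<open>Points as characters of the dual\<close>

definition dual_eval :: "'a::topological_ab_group_add \<Rightarrow> 'a dual \<Rightarrow> complex"
  where "dual_eval x d = circle_exp (Rep_dual d x)"

lemma Rep_dual_add: "Rep_dual d (x + y) = Rep_dual d x + Rep_dual d y"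
  using Rep_dual[of d] by (simp add: characters_def)

lemma Rep_dual_0: "Rep_dual d 0 = 0"
  using Rep_dual_add[of d 0 0] by simp

lemma Rep_dual_uminus: "Rep_dual d (- x) = - Rep_dual d x"
  using Rep_dual_add[of d x "- x"] by (simp add: Rep_dual_0 eq_neg_iff_add_eq_0 add.commute)

lemma unitary_character_dual_eval: "unitary_character (dual_eval x)"
  by (simp add: unitary_character_def dual_eval_def plus_dual.rep_eq circle_exp_add)

text \<open>This is where separation of points by continuous characters is used: it brings equality
  of evaluations back to equality in the group.\<close>

lemma inj_dual_eval:
  fixes x y :: "'a::{topological_ab_group_add, t2_space}"
  assumes X: "compact (UNIV :: 'a set)" and eq: "dual_eval x = dual_eval y"
  shows "x = y"
proof (rule ccontr)
  assume "x \<noteq> y"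
  then obtain \<phi> where \<phi>: "\<phi> \<in> characters" "\<phi> (x - y) \<noteq> 0"
    using characters_separate[OF X, of "x - y"] by auto
  have "\<phi> x = \<phi> y"
    using fun_cong[OF eq, of "Abs_dual \<phi>"] \<phi>(1) injD[OF inj_circle_exp]
    by (simp add: dual_eval_def Abs_dual_inverse)
  moreover have "\<phi> (x - y + y) = \<phi> (x - y) + \<phi> y"
    using \<phi>(1) unfolding characters_def by blast
  ultimately show False using \<phi>(2) by simp
qed

text \<open>If no such character existed, closeness to 1 on \<open>K\<close> would force real part
  at least 1/2 at x. The evaluations at \<open>H\<close> form a group of characters, so evaluation
  at x would be one of them, contradicting injectivity.\<close>

lemma characters_close_on_subgroup:
  fixes H :: "'a::{topological_ab_group_add, t2_space} set"
  assumes X: "compact (UNIV :: 'a set)" and H: "add_subgroup H" and "x \<notin> H"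
    and K: "finite K" "K \<subseteq> H" and "\<epsilon> > 0"
  shows "\<exists>\<phi>\<in>characters. (\<forall>h\<in>K. norm (circle_exp (\<phi> h) - 1) < \<epsilon>) \<and> Re (circle_exp (\<phi> x)) < 1 / 2"
proof (rule ccontr)
  assume *: "\<not> ?thesis"
  have "dual_eval x \<in> dual_eval ` H"
  proof (rule character_in_group_if_Re_ge[where F="dual_eval ` K" and \<epsilon>=\<epsilon>])
    have "dual_eval 0 \<in> dual_eval ` H" using H by (auto simp: add_subgroup_def)
    then show "(\<lambda>d. 1) \<in> dual_eval ` H" by (simp add: dual_eval_def[abs_def] Rep_dual_0)
    show "(\<lambda>d. f d * g d) \<in> dual_eval ` H" if fg: "f \<in> dual_eval ` H" "g \<in> dual_eval ` H" for f g
    proof -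
      obtain a b where "f = dual_eval a" "g = dual_eval b" "a \<in> H" "b \<in> H" using fg by blast
      then have "(\<lambda>d. f d * g d) = dual_eval (a + b)" "a + b \<in> H"
        using H by (auto simp: dual_eval_def fun_eq_iff Rep_dual_add circle_exp_add add_subgroup_def)
      then show ?thesis by simp
    qed
    show "(\<lambda>d. cnj (f d)) \<in> dual_eval ` H" if f: "f \<in> dual_eval ` H" for f
    proof -
      obtain a where "f = dual_eval a" "a \<in> H" using f by blast
      then have "(\<lambda>d. cnj (f d)) = dual_eval (- a)" "- a \<in> H"
        using H by (auto simp: dual_eval_def fun_eq_iff Rep_dual_uminus circle_exp_uminus add_subgroup_def)
      then show ?thesis by simp
    qed
    show "1 / 2 \<le> Re (dual_eval x d)" if "\<forall>f\<in>dual_eval ` K. norm (f d - 1) < \<epsilon>" for d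
    proof -
      have "\<forall>h\<in>K. norm (circle_exp (Rep_dual d h) - 1) < \<epsilon>"
        using that by (simp add: dual_eval_def)
      with * Rep_dual[of d] have "\<not> Re (circle_exp (Rep_dual d x)) < 1 / 2" by blast
      then show ?thesis by (simp add: dual_eval_def)
    qed
  qed (use K \<open>\<epsilon> > 0\<close> unitary_character_dual_eval in auto)
  then show False using inj_dual_eval[OF X] \<open>x \<notin> H\<close> by blast
qed

theorem corollary1p9:
  fixes H :: "'a::{topological_ab_group_add, t2_space} set"
  assumes "compact (UNIV :: 'a set)"
    and "add_subgroup H"
    and "countable H"
    and "infinite H"
  shows "g_closed H"
proof -
  have "x \<notin> g_closure H" if "x \<notin> H" for x
  proof -
    define h where "h = from_nat_into H"
    have "H \<noteq> {}" using assms(2) by (auto simp: add_subgroup_def)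
    then have h: "range h = H" using assms(3) by (simp add: h_def)
    \<comment> \<open>The finite set and the tolerance vary together with n; each point of H belongs
      to the set from its own index on.\<close>
    have "\<exists>\<phi>\<in>characters. (\<forall>y\<in>h ` {..n}. norm (circle_exp (\<phi> y) - 1) < 1 / real (Suc n))
        \<and> Re (circle_exp (\<phi> x)) < 1 / 2" for n
      by (rule characters_close_on_subgroup[OF assms(1,2) that]) (use h in auto)
    then obtain u where u: "\<And>n. u n \<in> characters"
      "\<And>n. \<forall>y\<in>h ` {..n}. norm (circle_exp (u n y) - 1) < 1 / real (Suc n)"
      "\<And>n. Re (circle_exp (u n x)) < 1 / 2"
      by metis
    have "H \<subseteq> s_set u"
    proof
      fix y assume "y \<in> H"
      then obtain i where i: "y = h i" using h by blast
      have "\<forall>\<^sub>F n in sequentially. norm (circle_exp (u n y) - 1) \<le> 1 / real (Suc n)"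
        using eventually_ge_at_top[of i] by eventually_elim (use u(2) i in \<open>auto intro: less_imp_le\<close>)
      then have "(\<lambda>n. circle_exp (u n y) - 1) \<longlonglongrightarrow> 0"
        by (rule Lim_null_comparison[OF _ lim_inverse_n'[THEN LIMSEQ_Suc]])
      then show "y \<in> s_set u"
        by (simp add: s_set_def LIM_zero_iff tendsto_circle_exp_iff)
    qed
    \<comment> \<open>The real parts at x stay below 1/2, whereas convergence to 0 in the circle
      would drive them to 1.\<close>
    moreover have "x \<notin> s_set u"
    proof
      assume "x \<in> s_set u"
      then have "(\<lambda>n. circle_exp (u n x)) \<longlonglongrightarrow> 1" by (simp add: s_set_def tendsto_circle_exp_iff)
      then have "(\<lambda>n. Re (circle_exp (u n x))) \<longlonglongrightarrow> 1" using tendsto_Re by fastforce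
      then have "1 \<le> (1 / 2 :: real)" using u(3) by (intro LIMSEQ_le_const2) (auto intro: less_imp_le)
      then show False by simp
    qed
    ultimately show ?thesis using u(1) by (auto simp: g_closure_def)
  qed
  moreover have "H \<subseteq> g_closure H" by (auto simp: g_closure_def)
  ultimately show ?thesis by (auto simp: g_closed_def)
qed

end
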